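(* Let $V$ be a finite-dimensional irreducible $\mathcal{A}$-module. Then the actions of $x,y,z$ on $V$ form a Leonard triple. If $V$ is of type $B$, then the Leonard triple is totally bipartite, and if $V$ is of type $AB$, then the Leonard triple is totally almost bipartite.
   Context: $\mathbb{K}$ is an algebraically closed field of characteristic zero. $\mathcal{A}$ is the unital associative $\mathbb{K}$-algebra with generators $x,y,z$ and relations $xy+yx=2z$, $yz+zy=2x$, $zx+xz=2y$. Type $B(d)$ ($d\ge 0$ even): an $\mathcal{A}$-module is of type $B(d)$ if it is isomorphic to the irreducible module with basis $\{v_i\}_{i=0}^d$ and, for $0\le i\le d$: $x.v_i=(-1)^i(d-2i)v_i$, $y.v_i=(d-i+1)v_{i-1}+(i+1)v_{i+1}$, $z.v_i=(-1)^{i-1}(d-i+1)v_{i-1}+(-1)^i(i+1)v_{i+1}$, with $v_{-1}=0=v_{d+1}$. Type $AB(d,n)$ ($d\ge 0$ an integer, $n\in\{0,x,y,z\}$): for $a\in\{x,y,z\}$ put $\widehat a(n)=1$ if $n\in\{0,a\}$ and $\widehat a(n)=-1$ otherwise. An $\mathcal{A}$-module is of type $AB(d,n)$ if it is isomorphic to the irreducible module with basis $\{v_i\}_{i=0}^d$ and, for $0\le i\le d$: $x.v_i=\widehat x(n)(-1)^{d+i}(2d-2i+1)v_i$, $y.v_i=\widehat y(n)(-1)^d\big((2d-i+2)v_{i-1}+(i+1)v_{i+1}\big)$, $z.v_i=\widehat z(n)\big((-1)^{i-1}(2d-i+2)v_{i-1}+(-1)^i(i+1)v_{i+1}\big)$,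 with $v_{-1}=0$, $v_{d+1}=v_d$. A module is of type $B$ if it is of type $B(d)$ for some even $d\ge0$, and of type $AB$ if it is of type $AB(d,n)$ for some $d\ge 0$, $n\in\{0,x,y,z\}$. (Every finite-dimensional irreducible $\mathcal{A}$-module is of exactly one of these types.) A tridiagonal matrix is irreducible if every subdiagonal and superdiagonal entry is nonzero. A tridiagonal matrix $B$ indexed by $0,\dots,d$ is bipartite if $B_{ii}=0$ for all $i$; it is almost bipartite if exactly one of $B_{00},B_{dd}$ is nonzero and $B_{ii}=0$ for $1\le i\le d-1$ (for $d=0$ this means $B_{00}\neq0$). A Leonard triple on a $\mathbb{K}$-vector space $V$ of finite positive dimension is an ordered triple of linear maps $V\to V$ such that for each of the three maps there is a basis of $V$ in which that map is diagonal and the other two are irreducible tridiagonal. It is totally bipartite (resp. totally almost bipartite) if all six tridiagonal matrices so arising are bipartite (resp. almost bipartite). *)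

theory Defs
  imports
    "HOL-Library.Poly_Mapping"
    "HOL-Computational_Algebra.Polynomial"
begin

section \<open>The algebra with generators $x,y,z$ and relations $xy+yx=2z$, $yz+zy=2x$, $zx+xz=2y$\<close>

datatype gen = GX | GY | GZ

text \<open>Words in the generators, i.e. the free monoid. The type class for monoids used as the
  exponents of a monoid algebra is \<^class>\<open>monoid_add\<close>, so concatenation is written additively
  (it is of course not commutative).\<close>

datatype word = Word (letters: "gen list")

instantiation word :: monoid_add
begin
definition "0 = Word []"
definition "u + w = Word (letters u @ letters w)"
instance by standard (auto simp: zero_word_def plus_word_def)
end

text \<open>The free algebra is the monoid algebra of the words: its product is the convolution
  product that is available for \<^type>\<open>poly_mapping\<close>.\<close>

type_synonym 'k free_alg = "word \<Rightarrow>\<^sub>0 'k"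

definition free_gen :: "gen \<Rightarrow> 'k::field free_alg"
  where "free_gen g = Poly_Mapping.single (Word [g]) 1"

definition free_scalar :: "'k::field \<Rightarrow> 'k free_alg"
  where "free_scalar c = Poly_Mapping.single 0 c"

definition relators :: "'k::field free_alg set"
  where "relators =
    {free_gen GX * free_gen GY + free_gen GY * free_gen GX - free_scalar 2 * free_gen GZ,
     free_gen GY * free_gen GZ + free_gen GZ * free_gen GY - free_scalar 2 * free_gen GX,
     free_gen GZ * free_gen GX + free_gen GX * free_gen GZ - free_scalar 2 * free_gen GY}"

text \<open>The two-sided ideal generated by the relators.\<close>

inductive_set rel_ideal :: "'k::field free_alg set" where
  relator: "r \<in> relators \<Longrightarrow> r \<in> rel_ideal"
| zero: "0 \<in> rel_ideal"
| add: "a \<in> rel_ideal \<Longrightarrow> b \<in> rel_ideal \<Longrightarrow> a + b \<in> rel_ideal"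
| left: "a \<in> rel_ideal \<Longrightarrow> p * a \<in> rel_ideal"
| right: "a \<in> rel_ideal \<Longrightarrow> a * p \<in> rel_ideal"

lemma rel_ideal_uminus: "a \<in> rel_ideal \<Longrightarrow> - a \<in> rel_ideal"
  using rel_ideal.left[of a "-1"] by simp

lemma rel_ideal_diff: "a \<in> rel_ideal \<Longrightarrow> b \<in> rel_ideal \<Longrightarrow> a - b \<in> rel_ideal"
  using rel_ideal.add[of a "- b"] rel_ideal_uminus[of b] by simp

definition rel_cong :: "'k::field free_alg \<Rightarrow> 'k free_alg \<Rightarrow> bool"
  where "rel_cong p q \<longleftrightarrow> p - q \<in> rel_ideal"

lemma equivp_rel_cong: "equivp (rel_cong :: 'k::field free_alg \<Rightarrow> _)"
proof (rule equivpI)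
  show "reflp (rel_cong :: 'k free_alg \<Rightarrow> _)"
    by (auto intro!: reflpI rel_ideal.zero simp: rel_cong_def)
  show "symp (rel_cong :: 'k free_alg \<Rightarrow> _)"
    using rel_ideal_uminus by (fastforce intro!: sympI simp: rel_cong_def)
  show "transp (rel_cong :: 'k free_alg \<Rightarrow> _)"
  proof (rule transpI)
    fix p q r :: "'k free_alg"
    assume "rel_cong p q" "rel_cong q r"
    then show "rel_cong p r"
      using rel_ideal.add[of "p - q" "q - r"] by (simp add: rel_cong_def)
  qed
qed

lemma lookup_mult_zero_word:
  fixes a b :: "'k::field free_alg"
  shows "Poly_Mapping.lookup (a * b) 0 = Poly_Mapping.lookup a 0 * Poly_Mapping.lookup b 0"
proof -
  have *: "(0 = l + q) \<longleftrightarrow> l = 0 \<and> q = 0" for l q :: word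
    by (cases l; cases q) (auto simp: zero_word_def plus_word_def)
  have "Sum_any (\<lambda>q. Poly_Mapping.lookup b q when 0 = l + q) =
      (Poly_Mapping.lookup b 0 when l = 0)" for l
  proof (cases "l = 0")
    case True
    then have "Sum_any (\<lambda>q. Poly_Mapping.lookup b q when 0 = l + q) =
        Sum_any (\<lambda>q. Poly_Mapping.lookup b q when q = 0)"
      by (intro Sum_any.cong) (auto simp: *)
    then show ?thesis using True by simp
  next
    case False
    then show ?thesis by (simp add: *)
  qed
  then show ?thesis
    by (simp add: lookup_mult mult_when)
qed

lemma rel_ideal_constant_coeff: "a \<in> rel_ideal \<Longrightarrow> Poly_Mapping.lookup a 0 = 0"
proof (induction rule: rel_ideal.induct)
  case (relator r)
  have "Poly_Mapping.lookup (free_gen g :: 'a free_alg) 0 = 0" for g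
    by (simp add: free_gen_def lookup_single zero_word_def when_def)
  then show ?case
    using relator by (auto simp: relators_def lookup_minus lookup_add lookup_mult_zero_word)
qed (auto simp: lookup_add lookup_mult_zero_word)

quotient_type (overloaded) 'k acsa = "'k::field free_alg" / rel_cong
  by (rule equivp_rel_cong)

instantiation acsa :: (field) ring_1
begin
lift_definition zero_acsa :: "'a acsa" is 0 .
lift_definition one_acsa :: "'a acsa" is 1 .
lift_definition plus_acsa :: "'a acsa \<Rightarrow> 'a acsa \<Rightarrow> 'a acsa" is "(+)"
proof -
  fix p p' q q' :: "'a free_alg"
  assume "rel_cong p p'" "rel_cong q q'"
  then show "rel_cong (p + q) (p' + q')"
    using rel_ideal.add[of "p - p'" "q - q'"] by (simp add: rel_cong_def algebra_simps)
qed
lift_definition uminus_acsa :: "'a acsa \<Rightarrow> 'a acsa" is uminus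
  unfolding rel_cong_def using rel_ideal_uminus by fastforce
lift_definition minus_acsa :: "'a acsa \<Rightarrow> 'a acsa \<Rightarrow> 'a acsa" is "(-)"
proof -
  fix p p' q q' :: "'a free_alg"
  assume "rel_cong p p'" "rel_cong q q'"
  then show "rel_cong (p - q) (p' - q')"
    using rel_ideal_diff[of "p - p'" "q - q'"] by (simp add: rel_cong_def algebra_simps)
qed
lift_definition times_acsa :: "'a acsa \<Rightarrow> 'a acsa \<Rightarrow> 'a acsa" is "(*)"
proof -
  fix p p' q q' :: "'a free_alg"
  assume "rel_cong p p'" "rel_cong q q'"
  then have "(p - p') * q + p' * (q - q') \<in> rel_ideal"
    by (auto simp: rel_cong_def intro: rel_ideal.intros)
  then show "rel_cong (p * q) (p' * q')"
    by (simp add: rel_cong_def algebra_simps)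
qed
instance
proof
  show "(0 :: 'a acsa) \<noteq> 1"
  proof transfer
    show "\<not> rel_cong (0 :: 'a free_alg) 1"
      using rel_ideal_constant_coeff[of "- 1 :: 'a free_alg"] by (auto simp: rel_cong_def)
  qed
qed (transfer; simp add: rel_cong_def rel_ideal.zero algebra_simps)+
end

lift_definition acsa_gen :: "gen \<Rightarrow> 'k::field acsa" is free_gen .

text \<open>The structure map from the ground field to the algebra.\<close>

lift_definition acsa_scalar :: "'k::field \<Rightarrow> 'k acsa" is free_scalar .

lemma acsa_relations:
  "acsa_gen GX * acsa_gen GY + acsa_gen GY * acsa_gen GX = acsa_scalar 2 * acsa_gen GZ"
  "acsa_gen GY * acsa_gen GZ + acsa_gen GZ * acsa_gen GY = acsa_scalar 2 * acsa_gen GX"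
  "acsa_gen GZ * acsa_gen GX + acsa_gen GX * acsa_gen GZ = acsa_scalar 2 * acsa_gen GY"
  by (transfer, auto simp: rel_cong_def relators_def intro!: rel_ideal.relator)+


section \<open>Modules\<close>

text \<open>The underlying vector space is the whole type. The axiom on scalars says that it is the
  vector space structure induced by the module structure; with \<open>c = 1\<close> it says that the
  module is unital.\<close>

locale acsa_module = vector_space scale
  for scale :: "'k::field \<Rightarrow> 'v::ab_group_add \<Rightarrow> 'v"
  and act :: "'k acsa \<Rightarrow> 'v \<Rightarrow> 'v" +
  assumes act_add_right: "act a (u + v) = act a u + act a v"
    and act_add_left: "act (a + b) v = act a v + act b v"
    and act_mult: "act (a * b) v = act a (act b v)"
    and act_scalar: "act (acsa_scalar c) v = scale c v"
begin

definition submodule :: "'v set \<Rightarrow> bool"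
  where "submodule W \<longleftrightarrow> subspace W \<and> (\<forall>a. \<forall>w\<in>W. act a w \<in> W)"

definition irreducible_module :: bool
  where "irreducible_module \<longleftrightarrow>
    (\<exists>v::'v. v \<noteq> 0) \<and> (\<forall>W. submodule W \<longrightarrow> W = {0} \<or> W = UNIV)"

definition finite_dimensional_module :: bool
  where "finite_dimensional_module \<longleftrightarrow> (\<exists>Basis. finite_dimensional_vector_space scale Basis)"

end


section \<open>Matrices and Leonard triples\<close>

text \<open>Square matrices with rows and columns indexed by \<open>0, \<dots>, d\<close> are functions of which only the
  values at indices \<open>\<le> d\<close> matter.\<close>

definition diagonal_matrix :: "nat \<Rightarrow> (nat \<Rightarrow> nat \<Rightarrow> 'k::zero) \<Rightarrow> bool"
  where "diagonal_matrix d B \<longleftrightarrow> (\<forall>i\<le>d. \<forall>j\<le>d. i \<noteq> j \<longrightarrow> B i j = 0)"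

definition tridiagonal :: "nat \<Rightarrow> (nat \<Rightarrow> nat \<Rightarrow> 'k::zero) \<Rightarrow> bool"
  where "tridiagonal d B \<longleftrightarrow> (\<forall>i\<le>d. \<forall>j\<le>d. i + 1 < j \<or> j + 1 < i \<longrightarrow> B i j = 0)"

definition irreducible_tridiagonal :: "nat \<Rightarrow> (nat \<Rightarrow> nat \<Rightarrow> 'k::zero) \<Rightarrow> bool"
  where "irreducible_tridiagonal d B \<longleftrightarrow>
    tridiagonal d B \<and> (\<forall>i<d. B (i + 1) i \<noteq> 0 \<and> B i (i + 1) \<noteq> 0)"

definition bipartite :: "nat \<Rightarrow> (nat \<Rightarrow> nat \<Rightarrow> 'k::zero) \<Rightarrow> bool"
  where "bipartite d B \<longleftrightarrow> tridiagonal d B \<and> (\<forall>i\<le>d. B i i = 0)"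

definition almost_bipartite :: "nat \<Rightarrow> (nat \<Rightarrow> nat \<Rightarrow> 'k::zero) \<Rightarrow> bool"
  where "almost_bipartite d B \<longleftrightarrow> tridiagonal d B \<and>
    (if d = 0 then B 0 0 \<noteq> 0 else (B 0 0 \<noteq> 0) \<noteq> (B d d \<noteq> 0)) \<and>
    (\<forall>i. 1 \<le> i \<and> i + 1 \<le> d \<longrightarrow> B i i = 0)"

definition basis_family :: "('k::field \<Rightarrow> 'v::ab_group_add \<Rightarrow> 'v) \<Rightarrow> nat \<Rightarrow> (nat \<Rightarrow> 'v) \<Rightarrow> bool"
  where "basis_family scale d v \<longleftrightarrow> inj_on v {0..d} \<and>
    \<not> module.dependent scale (v ` {0..d}) \<and> module.span scale (v ` {0..d}) = UNIV"

text \<open>Column \<open>j\<close> holds the coordinates of the image of the \<open>j\<close>-th basis vector.\<close>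

definition matrix_of ::
    "('k::field \<Rightarrow> 'v::ab_group_add \<Rightarrow> 'v) \<Rightarrow> nat \<Rightarrow> (nat \<Rightarrow> 'v) \<Rightarrow> ('v \<Rightarrow> 'v) \<Rightarrow> nat \<Rightarrow> nat \<Rightarrow> 'k"
  where "matrix_of scale d v T i j = module.representation scale (v ` {0..d}) (T (v j)) (v i)"

definition diag_tridiag_basis ::
    "('k::field \<Rightarrow> 'v::ab_group_add \<Rightarrow> 'v) \<Rightarrow> nat \<Rightarrow> (nat \<Rightarrow> 'v) \<Rightarrow>
     ('v \<Rightarrow> 'v) \<Rightarrow> ('v \<Rightarrow> 'v) \<Rightarrow> ('v \<Rightarrow> 'v) \<Rightarrow> bool"
  where "diag_tridiag_basis scale d v A B C \<longleftrightarrow> basis_family scale d v \<and>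
    diagonal_matrix d (matrix_of scale d v A) \<and>
    irreducible_tridiagonal d (matrix_of scale d v B) \<and>
    irreducible_tridiagonal d (matrix_of scale d v C)"

text \<open>That the space has finite positive dimension follows from the existence of a basis
  \<open>v 0, \<dots>, v d\<close>. The locale predicate \<open>Vector_Spaces.linear\<close> contains the vector space axioms.\<close>

definition leonard_triple ::
    "('k::field \<Rightarrow> 'v::ab_group_add \<Rightarrow> 'v) \<Rightarrow> ('v \<Rightarrow> 'v) \<Rightarrow> ('v \<Rightarrow> 'v) \<Rightarrow> ('v \<Rightarrow> 'v) \<Rightarrow> bool"
  where "leonard_triple scale A B C \<longleftrightarrow>
    Vector_Spaces.linear scale scale A \<and> Vector_Spaces.linear scale scale B \<and>
    Vector_Spaces.linear scale scale C \<and>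
    (\<exists>d v. diag_tridiag_basis scale d v A B C) \<and>
    (\<exists>d v. diag_tridiag_basis scale d v B C A) \<and>
    (\<exists>d v. diag_tridiag_basis scale d v C A B)"

text \<open>The bases in the definition of a Leonard triple are not unique, so the property is demanded
  of the tridiagonal matrices for every choice of these bases.\<close>

definition all_tridiagonal_matrices ::
    "(nat \<Rightarrow> (nat \<Rightarrow> nat \<Rightarrow> 'k) \<Rightarrow> bool) \<Rightarrow> ('k::field \<Rightarrow> 'v::ab_group_add \<Rightarrow> 'v) \<Rightarrow>
     ('v \<Rightarrow> 'v) \<Rightarrow> ('v \<Rightarrow> 'v) \<Rightarrow> ('v \<Rightarrow> 'v) \<Rightarrow> bool"
  where "all_tridiagonal_matrices P scale A B C \<longleftrightarrow>
    (\<forall>d v. diag_tridiag_basis scale d v A B C \<longrightarrow>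
       P d (matrix_of scale d v B) \<and> P d (matrix_of scale d v C)) \<and>
    (\<forall>d v. diag_tridiag_basis scale d v B C A \<longrightarrow>
       P d (matrix_of scale d v C) \<and> P d (matrix_of scale d v A)) \<and>
    (\<forall>d v. diag_tridiag_basis scale d v C A B \<longrightarrow>
       P d (matrix_of scale d v A) \<and> P d (matrix_of scale d v B))"

definition totally_bipartite ::
    "('k::field \<Rightarrow> 'v::ab_group_add \<Rightarrow> 'v) \<Rightarrow> ('v \<Rightarrow> 'v) \<Rightarrow> ('v \<Rightarrow> 'v) \<Rightarrow> ('v \<Rightarrow> 'v) \<Rightarrow> bool"
  where "totally_bipartite scale A B C \<longleftrightarrow>
    leonard_triple scale A B C \<and> all_tridiagonal_matrices bipartite scale A B C"

definition totally_almost_bipartite ::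
    "('k::field \<Rightarrow> 'v::ab_group_add \<Rightarrow> 'v) \<Rightarrow> ('v \<Rightarrow> 'v) \<Rightarrow> ('v \<Rightarrow> 'v) \<Rightarrow> ('v \<Rightarrow> 'v) \<Rightarrow> bool"
  where "totally_almost_bipartite scale A B C \<longleftrightarrow>
    leonard_triple scale A B C \<and> all_tridiagonal_matrices almost_bipartite scale A B C"


section \<open>The types of modules\<close>

text \<open>In \<open>type_AB_dn\<close> the parameter \<open>n\<close> ranges over \<open>{0, x, y, z}\<close>, with \<^const>\<open>None\<close> for \<open>0\<close>.\<close>

definition hat :: "gen \<Rightarrow> gen option \<Rightarrow> 'k::field"
  where "hat a n = (if n = None \<or> n = Some a then 1 else - 1)"

context acsa_module
begin

text \<open>A module is isomorphic to the module given by the action of the generators on a basis iff it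
  has a basis on which the generators act by the same formulas. The vectors \<open>lo i\<close> and \<open>hi i\<close>
  stand for $v_{i-1}$ and $v_{i+1}$ with the respective conventions at the boundary.
  The power \<open>(-1) ^ (i + 1)\<close> is $(-1)^{i-1}$, and the coefficients \<open>of_nat d - 2 * of_nat i\<close> etc. are
  computed in the field, so that there is no truncated subtraction.\<close>

definition type_B_d :: "nat \<Rightarrow> bool"
  where "type_B_d d \<longleftrightarrow> even d \<and> (\<exists>v. basis_family scale d v \<and>
    (let lo = (\<lambda>i. if i = 0 then 0 else v (i - 1));
         hi = (\<lambda>i. if i = d then 0 else v (i + 1))
     in \<forall>i\<le>d.
       act (acsa_gen GX) (v i) = scale ((- 1) ^ i * (of_nat d - 2 * of_nat i)) (v i) \<and>
       act (acsa_gen GY) (v i) =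
         scale (of_nat d - of_nat i + 1) (lo i) + scale (of_nat i + 1) (hi i) \<and>
       act (acsa_gen GZ) (v i) =
         scale ((- 1) ^ (i + 1) * (of_nat d - of_nat i + 1)) (lo i) +
         scale ((- 1) ^ i * (of_nat i + 1)) (hi i)))"

definition type_AB_dn :: "nat \<Rightarrow> gen option \<Rightarrow> bool"
  where "type_AB_dn d n \<longleftrightarrow> (\<exists>v. basis_family scale d v \<and>
    (let lo = (\<lambda>i. if i = 0 then 0 else v (i - 1));
         hi = (\<lambda>i. if i = d then v d else v (i + 1))
     in \<forall>i\<le>d.
       act (acsa_gen GX) (v i) =
         scale (hat GX n * (- 1) ^ (d + i) * (2 * of_nat d - 2 * of_nat i + 1)) (v i) \<and>
       act (acsa_gen GY) (v i) =
         scale (hat GY n * (- 1) ^ d)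
           (scale (2 * of_nat d - of_nat i + 2) (lo i) + scale (of_nat i + 1) (hi i)) \<and>
       act (acsa_gen GZ) (v i) =
         scale (hat GZ n)
           (scale ((- 1) ^ (i + 1) * (2 * of_nat d - of_nat i + 2)) (lo i) +
            scale ((- 1) ^ i * (of_nat i + 1)) (hi i))))"

definition type_B :: bool
  where "type_B \<longleftrightarrow> (\<exists>d. type_B_d d)"

definition type_AB :: bool
  where "type_AB \<longleftrightarrow> (\<exists>d n. type_AB_dn d n)"

end

end

theory Submission
  imports Defs
begin

text \<open>
  Write $P_e = y + e z$ for $e = \pm 1$. The relations give $x P_e = P_e (2 e - x)$, so $P_e$ maps
  the eigenspace of $x$ for $\theta$ to the one for $2 e - \theta$. The Casimir element
  $x^2 + y^2 + z^2$ is central and acts as a scalar $c - 1$, and $P_e^2 = c - (x - e)^2$. Applying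
  $P_{-e}, P_e, P_{-e}, \dots$ to an eigenvector $w_0$ of $x$ with $P_e w_0 \in \mathbb{K} w_0$
  therefore gives an eigenbasis of $x$ on which $y$ and $z$ are irreducible tridiagonal. Such a $w_0$
  exists: if $e$ is an eigenvalue of $x$, take it in that eigenspace, on which $P_e^2 = c$;
  otherwise follow $P_1 P_{-1}$, which raises eigenvalues by $4$, until it vanishes.

  Comparing the two ends of the chain yields $c = (\dim V)^2$ if $\pm 1$ are not eigenvalues of $x$
  and $c = 4 (\dim V)^2$ otherwise. As $c$ is symmetric in $x, y, z$, the three maps fall into the
  same case. In an eigenbasis of $x$ a diagonal entry of $y$ or $z$ can be nonzero only at an
  eigenvalue $\pm 1$; at an eigenvalue $e = \pm 1$ it is nonzero, since the eigenspace is a line on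
  which $P_e^2 = c \neq 0$.
\<close>

section \<open>Bases and eigenvectors\<close>

context vector_space
begin

text \<open>Set-based independence ignores repetitions in an indexed family, so injectivity is
  proved as well: \<open>v i = v j\<close> would be a relation with coefficients 1 and -1.\<close>

lemma independent_family:
  fixes d :: nat
  assumes indep: "\<And>a. (\<Sum>i\<le>d. a i *s v i) = 0 \<Longrightarrow> (\<forall>i\<le>d. a i = 0)"
  shows "inj_on v {..d}" "independent (v ` {..d})"
proof -
  show inj: "inj_on v {..d}"
  proof (rule inj_onI, rule ccontr)
    fix i j assume ij: "i \<in> {..d}" "j \<in> {..d}" "v i = v j" "i \<noteq> j"
    let ?a = "\<lambda>k. if k = i then 1 else if k = j then - 1 else 0"
    have "(\<Sum>k\<le>d. ?a k *s v k) = (\<Sum>k\<in>{i,j}. ?a k *s v k)"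
      using ij by (intro sum.mono_neutral_right) auto
    also have "\<dots> = 0" using ij by simp
    finally show False using indep[of ?a] ij by force
  qed
  show "independent (v ` {..d})"
  proof
    assume "dependent (v ` {..d})"
    then obtain u x where u: "x \<in> v ` {..d}" "u x \<noteq> 0" "(\<Sum>x\<in>v ` {..d}. u x *s x) = 0"
      by (auto simp: dependent_finite)
    then have "(\<Sum>i\<le>d. u (v i) *s v i) = 0" by (simp add: sum.reindex[OF inj])
    with indep[of "\<lambda>i. u (v i)"] u show False by auto
  qed
qed

lemma basis_familyI:
  assumes "\<And>a. (\<Sum>i\<le>d. a i *s v i) = 0 \<Longrightarrow> (\<forall>i\<le>d. a i = 0)"
    and "span (v ` {..d}) = UNIV"
  shows "basis_family scale d v"
  using independent_family[OF assms(1)] assms(2) by (simp add: basis_family_def atLeast0AtMost)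

lemma basis_family_coeffs_eq:
  assumes "basis_family scale d v" "(\<Sum>i\<le>d. a i *s v i) = (\<Sum>i\<le>d. b i *s v i)" "i \<le> d"
  shows "a i = b i"
proof -
  have inj: "inj_on v {..d}" and ind: "independent (v ` {..d})"
    using assms(1) by (auto simp: basis_family_def atLeast0AtMost)
  let ?u = "\<lambda>x. let k = the_inv_into {..d} v x in a k - b k"
  have "(\<Sum>x\<in>v ` {..d}. ?u x *s x) = (\<Sum>i\<le>d. (a i - b i) *s v i)"
    by (subst sum.reindex[OF inj]) (auto intro!: sum.cong simp: the_inv_into_f_f[OF inj])
  also have "\<dots> = 0" using assms(2) by (simp add: scale_left_diff_distrib sum_subtractf)
  finally have "?u (v i) = 0"
    using ind assms(3) by (auto simp: dependent_finite)
  then show ?thesis using assms(3) by (simp add: the_inv_into_f_f[OF inj])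
qed

section \<open>Coordinates and matrices with respect to a basis family\<close>

lemma matrix_of_sum:
  assumes "basis_family scale d v"
  shows "T (v j) = (\<Sum>i\<le>d. matrix_of scale d v T i j *s v i)"
proof -
  have inj: "inj_on v {..d}" and ind: "independent (v ` {..d})" and sp: "span (v ` {..d}) = UNIV"
    using assms by (auto simp: basis_family_def atLeast0AtMost)
  have "(\<Sum>b\<in>v ` {..d}. representation (v ` {..d}) (T (v j)) b *s b) = T (v j)"
    by (rule sum_representation_eq[OF ind]) (auto simp: sp)
  then show ?thesis by (simp add: sum.reindex[OF inj] matrix_of_def atLeast0AtMost)
qed

lemma basis_family_sum:
  assumes "basis_family scale d v"
  obtains a where "u = (\<Sum>i\<le>d. a i *s v i)"
  by (rule that) (rule matrix_of_sum[OF assms, where T = "\<lambda>_. u" and j = 0])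

lemma matrix_of_eq:
  assumes "basis_family scale d v" "T (v j) = (\<Sum>i\<le>d. b i *s v i)" "i \<le> d"
  shows "matrix_of scale d v T i j = b i"
  using basis_family_coeffs_eq[OF assms(1) _ assms(3), of "\<lambda>i. matrix_of scale d v T i j" b]
    matrix_of_sum[OF assms(1), of T j] assms(2) by simp

lemma basis_family_nonzero:
  assumes "basis_family scale d v" "i \<le> d"
  shows "v i \<noteq> 0"
  using assms dependent_zero[of "v ` {0..d}"] by (force simp: basis_family_def)

lemma basis_family_dim:
  assumes "basis_family scale d v"
  shows "dim (UNIV :: 'b set) = d + 1"
  using assms dim_eq_card[of "v ` {0..d}" UNIV] by (simp add: basis_family_def card_image)

lemma diagonal_matrix_of_iff:
  assumes "basis_family scale d v"
  shows "diagonal_matrix d (matrix_of scale d v A) \<longleftrightarrow> (\<exists>t. \<forall>i\<le>d. A (v i) = t i *s v i)"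
proof
  assume *: "diagonal_matrix d (matrix_of scale d v A)"
  have "A (v j) = matrix_of scale d v A j j *s v j" if "j \<le> d" for j
  proof -
    have "A (v j) = (\<Sum>i\<le>d. matrix_of scale d v A i j *s v i)"
      by (rule matrix_of_sum[OF assms])
    also have "\<dots> = (\<Sum>i\<in>{j}. matrix_of scale d v A i j *s v i)"
      using * that by (intro sum.mono_neutral_right) (auto simp: diagonal_matrix_def)
    finally show ?thesis by simp
  qed
  then show "\<exists>t. \<forall>i\<le>d. A (v i) = t i *s v i" by (intro exI[of _ "\<lambda>j. matrix_of scale d v A j j"]) simp
next
  assume "\<exists>t. \<forall>i\<le>d. A (v i) = t i *s v i"
  then obtain t where t: "\<And>i. i \<le> d \<Longrightarrow> A (v i) = t i *s v i" by auto
  have "A (v j) = (\<Sum>i\<le>d. (if i = j then t i else 0) *s v i)" if "j \<le> d" for j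
    using that by (simp add: t if_distrib[of "\<lambda>a. a *s _"] cong: if_cong)
  then show "diagonal_matrix d (matrix_of scale d v A)"
    unfolding diagonal_matrix_def by (auto simp: matrix_of_eq[OF assms])
qed

lemma irreducible_tridiagonalI:
  assumes bf: "basis_family scale d v"
    and T: "\<And>j. j \<le> d \<Longrightarrow> T (v j) = (if j < d then a j *s v (j + 1) else 0)
      + (if 0 < j then b j *s v (j - 1) else 0) + e j *s v j"
    and a: "\<And>j. j < d \<Longrightarrow> a j \<noteq> 0" and b: "\<And>j. j < d \<Longrightarrow> b (j + 1) \<noteq> 0"
  shows "irreducible_tridiagonal d (matrix_of scale d v T)"
proof -
  let ?B = "\<lambda>j i. if i = j + 1 then a j else if i + 1 = j then b j else if i = j then e j else 0"
  have "T (v j) = (\<Sum>i\<le>d. ?B j i *s v i)" if "j \<le> d" for j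
  proof -
    \<comment> \<open>For \<open>j = 0\<close> the truncated \<open>j - 1\<close> is 0, hence the
      inner guard \<open>0 < j\<close>.\<close>
    have "(\<Sum>i\<le>d. ?B j i *s v i) = (\<Sum>i\<le>d. (if i = j + 1 then a j *s v i else 0)
      + (if i = j - 1 then if 0 < j then b j *s v i else 0 else 0) + (if i = j then e j *s v i else 0))"
      by (intro sum.cong) auto
    also have "\<dots> = T (v j)" using that by (auto simp: T sum.distrib)
    finally show ?thesis by simp
  qed
  then have "matrix_of scale d v T i j = ?B j i" if "i \<le> d" "j \<le> d" for i j
    using that by (intro matrix_of_eq[OF bf])
  then show ?thesis using a b
    unfolding irreducible_tridiagonal_def tridiagonal_def by auto
qed

text \<open>Applying \<open>T - t s\<close> to a relation kills the summand at \<open>s\<close> and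
  multiplies the others by the nonzero differences \<open>t i - t s\<close>.\<close>

lemma sum_eigenvectors_zero:
  assumes T: "Vector_Spaces.linear scale scale T"
    and "finite S" "inj_on t S" "\<And>i. i \<in> S \<Longrightarrow> T (v i) = t i *s v i" "\<And>i. i \<in> S \<Longrightarrow> v i \<noteq> 0"
    and "(\<Sum>i\<in>S. a i *s v i) = 0"
  shows "\<forall>i\<in>S. a i = 0"
  using assms(2-)
proof (induction S arbitrary: a rule: finite_induct)
  case (insert s S)
  interpret T: Vector_Spaces.linear scale scale T by (rule T)
  let ?u = "\<Sum>i\<in>S. a i *s v i"
  have u: "?u = - (a s *s v s)" using insert by (simp add: eq_neg_iff_add_eq_0 add.commute)
  have "(\<Sum>i\<in>S. (a i * (t i - t s)) *s v i) = (\<Sum>i\<in>S. a i *s T (v i)) - t s *s ?u"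
    unfolding scale_sum_right sum_subtractf[symmetric] using insert.prems(2)
    by (intro sum.cong) (auto simp: algebra_simps)
  also have "(\<Sum>i\<in>S. a i *s T (v i)) = T ?u" by (simp add: T.sum T.scale)
  also have "T ?u - t s *s ?u = 0" unfolding u using insert.prems by (simp add: T.neg T.scale)
  finally have "\<forall>i\<in>S. a i * (t i - t s) = 0"
    using insert.prems by (intro insert.IH) auto
  moreover have "t i \<noteq> t s" if "i \<in> S" for i
    using insert.hyps insert.prems(1) that by (auto simp: image_iff)
  ultimately have S: "\<forall>i\<in>S. a i = 0" by auto
  then have "a s *s v s = 0" using u by simp
  with S insert.prems show ?case by auto
qed simp

text \<open>Comparing coefficients in \<open>T u = \<theta> *s u\<close> shows that only basis
  vectors with eigenvalue \<theta> occur in \<open>u\<close>. Injectivity is a premise of the last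
  claim alone, so that the lemma also serves bases whose eigenvalues are not yet known to be
  distinct.\<close>

lemma eigenvector_in_eigenbasis:
  assumes bf: "basis_family scale d v" and T: "Vector_Spaces.linear scale scale T"
    and t: "\<And>i. i \<le> d \<Longrightarrow> T (v i) = t i *s v i"
    and u: "T u = \<theta> *s u" "u \<noteq> 0"
  obtains i where "i \<le> d" "t i = \<theta>" "inj_on t {..d} \<Longrightarrow> \<exists>a. u = a *s v i"
proof -
  interpret T: Vector_Spaces.linear scale scale T by (rule T)
  obtain a where a: "u = (\<Sum>i\<le>d. a i *s v i)" by (rule basis_family_sum[OF bf])
  have "(\<Sum>i\<le>d. (a i * t i) *s v i) = T u" using t by (simp add: a T.sum T.scale)
  also have "\<dots> = (\<Sum>i\<le>d. (\<theta> * a i) *s v i)" unfolding u(1) by (simp add: a scale_sum_right)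
  finally have *: "(\<Sum>i\<le>d. (a i * t i) *s v i) = (\<Sum>i\<le>d. (\<theta> * a i) *s v i)" .
  have eq: "a i * t i = \<theta> * a i" if "i \<le> d" for i
    using basis_family_coeffs_eq[OF bf * that] .
  have "\<exists>i\<le>d. a i \<noteq> 0"
  proof (rule ccontr)
    assume "\<not> ?thesis"
    then have "u = 0" unfolding a by (intro sum.neutral) auto
    with u(2) show False ..
  qed
  then obtain i where i: "i \<le> d" "a i \<noteq> 0" by blast
  have "u = a i *s v i" if inj: "inj_on t {..d}"
  proof -
    have "a j = 0" if "j \<le> d" "j \<noteq> i" for j
      using eq[OF that(1)] eq[OF i(1)] i that inj by (auto simp: inj_on_def mult.commute)
    then have "u = (\<Sum>j\<in>{i}. a j *s v j)" unfolding a using i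
      by (intro sum.mono_neutral_right) auto
    then show ?thesis by simp
  qed
  with i eq[OF i(1)] that[of i] show thesis by (auto simp: mult.commute)
qed

end

section \<open>Existence of eigenvectors over an algebraically closed field\<close>

context finite_dimensional_vector_space
begin

text \<open>Stated for infinite sequences, to fit both the powers \<open>(T ^^ i) v\<close> and
  sequences of eigenvectors.\<close>

lemma too_many_dependent:
  fixes v :: "nat \<Rightarrow> 'b"
  obtains a n where "(\<Sum>i\<le>n. a i *s v i) = 0" "\<exists>i\<le>n. a i \<noteq> 0"
proof (rule ccontr)
  assume "\<not> thesis"
  with that have indep: "(\<Sum>i\<le>n. a i *s v i) = 0 \<Longrightarrow> (\<forall>i\<le>n. a i = 0)" for a n by blast
  let ?n = "dim (UNIV :: 'b set)"
  have inj: "inj_on v {..?n}" and "independent (v ` {..?n})"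
    using independent_family[OF indep] by blast+
  then have "card (v ` {..?n}) \<le> ?n" by (intro independent_card_le_dim) auto
  then show False by (simp only: card_image[OF inj] card_atMost)
qed

end

text \<open>Split off a root \<open>a\<close>, so that p = (X - a) q. Either
  \<open>T v = a *s v\<close>, or q annihilates the nonzero vector \<open>T v - a *s v\<close> and
  has smaller degree.\<close>

lemma (in vector_space) eigenvector_of_annihilating_poly:
  fixes p :: "'a poly"
  assumes T: "Vector_Spaces.linear scale scale T"
    and ac: "\<And>q :: 'a poly. degree q > 0 \<Longrightarrow> \<exists>z. poly q z = 0"
    and "p \<noteq> 0" "v \<noteq> 0" "degree p \<le> n" "(\<Sum>i\<le>n. coeff p i *s (T ^^ i) v) = 0"
  shows "\<exists>u a. u \<noteq> 0 \<and> T u = a *s u"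
  using assms(3-)
proof (induction n arbitrary: p v)
  case 0
  then show ?case by (auto elim!: degree_eq_zeroE)
next
  case (Suc n)
  interpret T: Vector_Spaces.linear scale scale T by (rule T)
  have Tn: "Vector_Spaces.linear scale scale (T ^^ i)" for i
  proof (induction i)
    case (Suc i)
    then show ?case unfolding funpow.simps by (rule Vector_Spaces.linear_compose[OF _ T])
  qed (simp add: linear_id[unfolded id_def] id_def)
  show ?case
  proof (cases "degree p = 0")
    case True
    then obtain c where c: "p = [:c:]" by (rule degree_eq_zeroE)
    have "(\<Sum>i\<le>Suc n. coeff p i *s (T ^^ i) v) = (\<Sum>i\<in>{0}. coeff p i *s (T ^^ i) v)"
      by (intro sum.mono_neutral_right) (auto simp: c coeff_pCons split: nat.splits)
    with Suc.prems show ?thesis by (simp add: c)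
  next
    case False
    then obtain a where "poly p a = 0" using ac by auto
    then obtain q where q: "p = [:- a, 1:] * q" by (auto simp: poly_eq_0_iff_dvd)
    with Suc.prems have q0: "q \<noteq> 0" by auto
    then have deg: "degree p = Suc (degree q)" unfolding q by (subst degree_mult_eq) auto
    let ?v = "T v - a *s v"
    show ?thesis
    proof (cases "?v = 0")
      case True
      then show ?thesis using Suc.prems by auto
    next
      case False
      have Tv: "(T ^^ i) ?v = (T ^^ Suc i) v - a *s (T ^^ i) v" for i
      proof -
        interpret Ti: Vector_Spaces.linear scale scale "T ^^ i" by (rule Tn)
        show ?thesis by (simp add: Ti.diff Ti.scale funpow_swap1)
      qed
      have cp: "coeff p i = coeff (pCons 0 q) i - a * coeff q i" for i by (simp add: q)
      have qn: "coeff q (Suc n) = 0" using deg Suc.prems by (intro coeff_eq_0) auto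
      \<comment> \<open>The second sum may run to \<open>Suc n\<close> since
        \<open>coeff q (Suc n) = 0\<close>; the first becomes the sum for X q after an index shift,
        so the difference is the relation given by p.\<close>
      have "(\<Sum>i\<le>n. coeff q i *s (T ^^ i) ?v) =
        (\<Sum>i\<le>n. coeff q i *s (T ^^ Suc i) v) - (\<Sum>i\<le>Suc n. (a * coeff q i) *s (T ^^ i) v)"
        unfolding Tv by (simp add: scale_right_diff_distrib sum_subtractf qn mult.commute)
      also have "(\<Sum>i\<le>n. coeff q i *s (T ^^ Suc i) v) =
          (\<Sum>i\<le>Suc n. coeff (pCons 0 q) i *s (T ^^ i) v)"
        by (subst sum.atMost_Suc_shift) simp
      also have "\<dots> - (\<Sum>i\<le>Suc n. (a * coeff q i) *s (T ^^ i) v)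
          = (\<Sum>i\<le>Suc n. coeff p i *s (T ^^ i) v)"
        unfolding sum_subtractf[symmetric] cp by (simp only: scale_left_diff_distrib)
      finally show ?thesis using Suc False q0 deg by (intro Suc.IH[of q ?v]) auto
    qed
  qed
qed

text \<open>A linear dependence among v, T v, T^2 v, ... is a nonzero polynomial that annihilates
  v.\<close>

lemma exists_eigenvector:
  fixes scale :: "'k::{alg_closed_field} \<Rightarrow> 'v::ab_group_add \<Rightarrow> 'v"
  assumes "finite_dimensional_vector_space scale Basis"
    and T: "Vector_Spaces.linear scale scale T" and v: "v \<noteq> (0 :: 'v)"
  obtains u a where "u \<noteq> 0" "T u = scale a u"
proof -
  interpret finite_dimensional_vector_space scale Basis by fact
  obtain a n where a: "(\<Sum>i\<le>n. scale (a i) ((T ^^ i) v)) = 0" "\<exists>i\<le>n. a i \<noteq> 0"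
    by (rule too_many_dependent)
  define p where "p = Poly (map a [0..<Suc n])"
  have c: "coeff p i = (if i \<le> n then a i else 0)" for i
    by (auto simp: p_def coeff_Poly_eq nth_default_def simp del: upt_Suc)
  have "p \<noteq> 0" using a(2) c by (metis coeff_0)
  moreover have "degree p \<le> n" by (intro degree_le) (simp add: c)
  moreover have "(\<Sum>i\<le>n. scale (coeff p i) ((T ^^ i) v)) = 0"
    using a(1) by (simp add: c)
  ultimately show thesis
    using eigenvector_of_annihilating_poly[OF T _ _ v, of p n] that
    by (meson alg_closed_imp_poly_has_root)
qed

section \<open>Eigenvector chains\<close>

text \<open>The module as three operators, with assumptions that are invariant under cyclic rotation
  of \<open>X\<close>, \<open>Y\<close>, \<open>Z\<close>.\<close>

locale anticommutator_module = finite_dimensional_vector_space scale Basis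
  for scale :: "'k::{alg_closed_field, field_char_0} \<Rightarrow> 'v::ab_group_add \<Rightarrow> 'v" (infixr "*s" 75)
    and Basis :: "'v set" +
  fixes X Y Z :: "'v \<Rightarrow> 'v"
  assumes linear_X: "Vector_Spaces.linear scale scale X"
    and linear_Y: "Vector_Spaces.linear scale scale Y"
    and linear_Z: "Vector_Spaces.linear scale scale Z"
    and XY: "X (Y v) + Y (X v) = 2 *s Z v"
    and YZ: "Y (Z v) + Z (Y v) = 2 *s X v"
    and ZX: "Z (X v) + X (Z v) = 2 *s Y v"
    and nontrivial: "\<exists>v :: 'v. v \<noteq> 0"
    and irreducible: "subspace W \<Longrightarrow> (\<And>w. w \<in> W \<Longrightarrow> X w \<in> W \<and> Y w \<in> W \<and> Z w \<in> W)
      \<Longrightarrow> W = {0} \<or> W = UNIV"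
begin

sublocale X: Vector_Spaces.linear scale scale X by (rule linear_X)
sublocale Y: Vector_Spaces.linear scale scale Y by (rule linear_Y)
sublocale Z: Vector_Spaces.linear scale scale Z by (rule linear_Z)

text \<open>Schur's argument: an eigenspace of the Casimir operator is invariant and nonzero, hence
  everything.\<close>

lemma casimir_scalar: "\<exists>a. \<forall>v. X (X v) + Y (Y v) + Z (Z v) = a *s v"
proof -
  define C where "C v = X (X v) + Y (Y v) + Z (Z v)" for v
  have linear_C: "Vector_Spaces.linear scale scale C"
    by unfold_locales
      (auto simp: C_def X.add X.scale Y.add Y.scale Z.add Z.scale algebra_simps)
  interpret C: Vector_Spaces.linear scale scale C by (rule linear_C)
  \<comment> \<open>Oriented so that rewriting brings every composition into the order
    \<open>Y\<close>, \<open>Z\<close>, \<open>X\<close>; the commutation laws then follow by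
    comparing normal forms.\<close>
  have swap: "X (Y v) = 2 *s Z v - Y (X v)" "X (Z v) = 2 *s Y v - Z (X v)"
    "Z (Y v) = 2 *s X v - Y (Z v)" for v
    using XY[of v] YZ[of v] ZX[of v] by (simp_all add: eq_diff_eq add.commute)
  have comm: "C (X v) = X (C v)" "C (Y v) = Y (C v)" "C (Z v) = Z (C v)" for v
    by (simp_all add: C_def swap X.add X.scale X.diff Y.add Y.scale Y.diff Z.add Z.scale Z.diff
        algebra_simps)
  obtain v0 :: 'v where "v0 \<noteq> 0" using nontrivial by blast
  then obtain u a where u: "u \<noteq> 0" "C u = a *s u"
    using exists_eigenvector[OF finite_dimensional_vector_space_axioms linear_C] by metis
  have "{v. C v = a *s v} = {0} \<or> {v. C v = a *s v} = UNIV"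
    by (rule irreducible)
      (auto simp: subspace_def C.add C.scale comm X.scale Y.scale Z.scale algebra_simps)
  with u have "{v. C v = a *s v} = UNIV" by auto
  then show ?thesis unfolding C_def by blast
qed

end

text \<open>Writing the Casimir scalar as \<open>c - 1\<close> absorbs the 1 from completing the
  square in \<open>P_eigenvector\<close>.\<close>

locale anticommutator_triple = anticommutator_module +
  fixes c :: 'a
  assumes casimir: "X (X v) + Y (Y v) + Z (Z v) = (c - 1) *s v"
begin

text \<open>Carries every result about eigenbases of \<open>X\<close> over to \<open>Y\<close> and
  \<open>Z\<close>, with the same \<open>c\<close>.\<close>

lemma rotate: "anticommutator_triple scale Basis Y Z X c"
  using XY YZ ZX casimir nontrivial irreducible
  by unfold_locales (auto simp: add.commute add.left_commute add.assoc)

section \<open>The operators y + e z and their effect on eigenvectors of x\<close>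

definition P :: "'a \<Rightarrow> 'b \<Rightarrow> 'b"
  where "P e v = Y v + e *s Z v"

lemma linear_P: "Vector_Spaces.linear scale scale (P e)"
  by unfold_locales (auto simp: P_def Y.add Y.scale Z.add Z.scale algebra_simps)

sublocale P: Vector_Spaces.linear scale scale "P e" for e by (rule linear_P)

lemma X_P:
  assumes "e * e = 1"
  shows "X (P e v) = (2 * e) *s P e v - P e (X v)"
proof -
  have "X (P e v) + P e (X v) = (X (Y v) + Y (X v)) + e *s (Z (X v) + X (Z v))"
    by (simp add: P_def X.add X.scale algebra_simps)
  also have "\<dots> = (2 * e) *s P e v"
    unfolding XY ZX by (simp add: P_def scale_right_distrib mult.assoc assms mult.commute[of e 2])
  finally show ?thesis by (simp add: eq_diff_eq)
qed

text \<open>The mixed terms are e (yz + zy) = 2 e x, and y^2 + z^2 is the Casimir element minus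
  x^2.\<close>

lemma P_P:
  assumes "e * e = 1"
  shows "P e (P e v) = (c - 1) *s v - X (X v) + (2 * e) *s X v"
proof -
  have "P e (P e v) = Y (Y v) + e *s (Y (Z v) + Z (Y v)) + (e * e) *s Z (Z v)"
    by (simp add: P_def Y.add Y.scale Z.add Z.scale algebra_simps)
  also have "\<dots> = (X (X v) + Y (Y v) + Z (Z v)) - X (X v) + (2 * e) *s X v"
    unfolding YZ assms by (simp add: algebra_simps)
  finally show ?thesis unfolding casimir .
qed

lemma P_eigenvector:
  assumes "e * e = 1" "X v = \<theta> *s v"
  shows "X (P e v) = (2 * e - \<theta>) *s P e v" "P e (P e v) = (c - (\<theta> - e)\<^sup>2) *s v"
proof -
  show "X (P e v) = (2 * e - \<theta>) *s P e v"
    by (simp add: X_P[OF assms(1)] assms(2) P.scale algebra_simps)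
  have *: "c - (\<theta> - e)\<^sup>2 = (c - 1) - \<theta> * \<theta> + 2 * e * \<theta>"
    using assms(1) by (simp add: power2_eq_square algebra_simps)
  show "P e (P e v) = (c - (\<theta> - e)\<^sup>2) *s v"
    unfolding * by (simp add: P_P[OF assms(1)] assms(2) X.scale algebra_simps)
qed

text \<open>Valid for both signs, so that along a chain the sign can follow the parity of the
  index.\<close>

lemma Y_Z_P:
  assumes "e * e = 1"
  shows "Y v = (1 / 2) *s (P e v + P (- e) v)" "Z v = (e / 2) *s (P e v - P (- e) v)"
proof -
  have double: "(2 * a) *s u = a *s u + a *s u" for a u
    unfolding scale_left_distrib[symmetric] by simp
  have "P e v + P (- e) v = 2 *s Y v" "P e v - P (- e) v = (2 * e) *s Z v"
    using double[of 1] by (simp_all add: P_def double)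
  then show "Y v = (1 / 2) *s (P e v + P (- e) v)" "Z v = (e / 2) *s (P e v - P (- e) v)"
    using assms by simp_all
qed

section \<open>Eigenbases of x built as chains\<close>

definition eigenvalue :: "'a \<Rightarrow> bool"
  where "eigenvalue a \<longleftrightarrow> (\<exists>u. u \<noteq> 0 \<and> X u = a *s u)"

text \<open>Infinitely many distinct eigenvalues are impossible in finite dimension. Distinctness is
  demanded only under nonvanishing, because the argument for it in \<open>chain_basis\<close> relies
  on nonzero vectors.\<close>

lemma eigenvector_sequence_vanishes:
  fixes w :: "nat \<Rightarrow> 'b"
  assumes "\<And>i. X (w i) = t i *s w i" "\<And>i j. (\<And>k. w k \<noteq> 0) \<Longrightarrow> i < j \<Longrightarrow> t i \<noteq> t j"
  shows "\<exists>n. w n = 0"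
proof (rule ccontr)
  assume "\<not> ?thesis"
  then have nz: "w n \<noteq> 0" for n by auto
  then have "inj t" by (intro linorder_injI) (use assms(2) in auto)
  obtain a n where "(\<Sum>i\<le>n. a i *s w i) = 0" "\<exists>i\<le>n. a i \<noteq> 0" by (rule too_many_dependent)
  then show False
    using sum_eigenvectors_zero[OF linear_X finite_atMost inj_on_subset[OF \<open>inj t\<close> subset_UNIV],
      of n w a] assms(1) nz by auto
qed

definition eigenbasis :: "nat \<Rightarrow> (nat \<Rightarrow> 'b) \<Rightarrow> (nat \<Rightarrow> 'a) \<Rightarrow> bool"
  where "eigenbasis d w t \<longleftrightarrow> basis_family scale d w \<and> (\<forall>i\<le>d. X (w i) = t i *s w i)"

lemma eigenvalue_eigenbasis:
  assumes "eigenbasis d w t"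
  shows "eigenvalue a \<longleftrightarrow> (\<exists>i\<le>d. t i = a)"
proof
  assume "eigenvalue a"
  then obtain u where "X u = a *s u" "u \<noteq> 0" by (auto simp: eigenvalue_def)
  with assms eigenvector_in_eigenbasis[OF _ linear_X, of d w t u a]
  show "\<exists>i\<le>d. t i = a" by (metis eigenbasis_def)
next
  assume "\<exists>i\<le>d. t i = a"
  then obtain i where "i \<le> d" "t i = a" by auto
  with assms show "eigenvalue a" unfolding eigenbasis_def eigenvalue_def
    by (intro exI[of _ "w i"]) (auto simp: basis_family_nonzero)
qed

text \<open>The hypothesis \<open>start\<close> covers two ways to begin: \<open>P e\<close> kills
  \<open>w0\<close>, or \<open>w0\<close> lies in the eigenspace for \<open>e\<close>, where the
  chain has a loop with factor \<open>r\<close>. The eigenvalues arise by alternating \<theta> ->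
  -2e - \<theta> and \<theta> -> 2e - \<theta>.\<close>

lemma chain_basis:
  assumes e: "e = 1 \<or> e = - 1" and w0: "w0 \<noteq> 0" "X w0 = \<theta> *s w0" "P e w0 = r *s w0"
    and start: "r = 0 \<and> \<not> eigenvalue 1 \<and> \<not> eigenvalue (- 1) \<or> \<theta> = e"
  obtains d w where "eigenbasis d w (\<lambda>i. (- 1) ^ i * (\<theta> + 2 * e * of_nat i))"
    "inj_on (\<lambda>i. (- 1) ^ i * (\<theta> + 2 * e * of_nat i)) {..d}"
    "irreducible_tridiagonal d (matrix_of scale d w Y)"
    "irreducible_tridiagonal d (matrix_of scale d w Z)"
    "c = (if \<theta> = e then 4 else 1) * (of_nat d + 1)\<^sup>2"
proof -
  define t where "t i = (- 1) ^ i * (\<theta> + 2 * e * of_nat i)" for i :: nat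
  \<comment> \<open>The first step uses \<open>P (- e)\<close>, as \<open>P e\<close> only returns a
    multiple of \<open>w0\<close>.\<close>
  define w where "w = rec_nat w0 (\<lambda>i. P (- (e * (- 1) ^ i)))"
  have w_0: "w 0 = w0" and w_Suc: "w (Suc i) = P (- (e * (- 1) ^ i)) (w i)" for i
    by (simp_all add: w_def)
  have ee: "e * e = 1" and e0: "e \<noteq> 0" using e by auto
  have ei: "(e * (- 1) ^ i) * (e * (- 1) ^ i) = 1" for i :: nat
    using e by (cases "even i") auto
  have ei': "- (e * (- 1) ^ i) * - (e * (- 1) ^ i) = 1" for i :: nat
    using ei[of i] by simp
  have Xw: "X (w i) = t i *s w i" for i
  proof (induction i)
    case (Suc i)
    have "2 * - (e * (- 1) ^ i) - t i = t (Suc i)" by (simp add: t_def algebra_simps)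
    then show ?case unfolding w_Suc by (simp only: P_eigenvector(1)[OF ei' Suc])
  qed (simp add: w_0 w0 t_def)
  \<comment> \<open>The operator leading from \<open>w i\<close> to \<open>w (Suc i)\<close> also
    leads back, since its square is a scalar on \<open>w i\<close>; \<open>g i\<close> is that
    scalar.\<close>
  define g where "g i = c - (\<theta> + e * (2 * of_nat i + 1))\<^sup>2" for i :: nat
  have down: "P (- (e * (- 1) ^ i)) (w (Suc i)) = g i *s w i" for i
  proof -
    have "(t i - - (e * (- 1) ^ i))\<^sup>2 = (\<theta> + e * (2 * of_nat i + 1))\<^sup>2"
      by (cases "even i") (simp_all add: t_def power2_eq_square algebra_simps)
    then show ?thesis unfolding w_Suc P_eigenvector(2)[OF ei' Xw] g_def by simp
  qed
  have t_neq: "t i \<noteq> t j" if ij: "i < j" and nz: "\<And>k. k < j \<Longrightarrow> w k \<noteq> 0" for i j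
  proof
    assume eq: "t i = t j"
    show False
    proof (cases "even i = even j")
      case True
      then have "\<theta> + 2 * e * of_nat i = \<theta> + 2 * e * of_nat j"
        using eq by (cases "even i") (auto simp: t_def)
      then show False using e0 ij by simp
    next
      case False
      have "a = - b" if "(- 1) ^ i * a = (- 1) ^ j * b" for a b :: 'a
        using that False by (cases "even i") auto
      from this[OF eq[unfolded t_def]] have "2 * (\<theta> + e * of_nat (i + j)) = 0" by (simp add: algebra_simps)
      then have \<theta>: "\<theta> = - (e * of_nat (i + j))" by (simp only: mult_eq_0_iff) (simp add: eq_neg_iff_add_eq_0)
      from start show False
      proof
        assume "\<theta> = e"
        with \<theta> have "e * of_nat (i + j + 1) = 0" by (simp add: algebra_simps eq_neg_iff_add_eq_0)
        then show False using e0 by (simp only: mult_eq_0_iff of_nat_eq_0_iff) simp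
      next
        assume *: "r = 0 \<and> \<not> eigenvalue 1 \<and> \<not> eigenvalue (- 1)"
        \<comment> \<open>The vector \<open>w m\<close> halfway between \<open>i\<close> and
          \<open>j\<close> comes before \<open>w j\<close>, hence is nonzero, and its eigenvalue is
          1 or -1, which is excluded here.\<close>
        from False have "odd (i + j)" by auto
        then obtain m where m: "i + j = 2 * m + 1" by (rule oddE)
        have "t m = - ((- 1) ^ m * e)" unfolding t_def \<theta> m by (simp add: algebra_simps)
        then have "t m = 1 \<or> t m = - 1" using e by (cases "even m") auto
        moreover have "w m \<noteq> 0" using m ij by (intro nz) auto
        ultimately show False using * Xw[of m] unfolding eigenvalue_def by metis
      qed
    qed
  qed
  have "\<exists>n. w n = 0"
    using t_neq by (intro eigenvector_sequence_vanishes[of w t]) (auto simp: Xw)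
  define n where "n = (LEAST n. w n = 0)"
  have "w n = 0" unfolding n_def by (rule LeastI_ex) fact
  moreover from this obtain d where "n = Suc d" using w0(1) w_0 by (cases n) auto
  ultimately have wd: "w (Suc d) = 0" by simp
  have nz: "w i \<noteq> 0" if "i \<le> d" for i
    using that \<open>n = Suc d\<close> not_less_Least[of i "\<lambda>n. w n = 0"] by (auto simp: n_def)
  have inj: "inj_on t {..d}"
    using t_neq nz by (intro linorder_inj_onI) auto
  \<comment> \<open>The upper end of the chain determines \<open>c\<close>: the way back from 0
    forces \<open>g d = 0\<close>.\<close>
  have "g d *s w d = 0" using down[of d] unfolding wd by simp
  then have c: "c = (\<theta> + e * (2 * of_nat d + 1))\<^sup>2" using nz[of d] by (simp add: g_def)
  \<comment> \<open>Multiplying by \<open>e\<close> lets both signs be treated at once.\<close>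
  define \<theta>' where "\<theta>' = e * \<theta>"
  have \<theta>: "\<theta> = e * \<theta>'" using ee by (simp add: \<theta>'_def flip: mult.assoc)
  have sq: "(e * a)\<^sup>2 = a\<^sup>2" for a using ee by (simp add: power_mult_distrib power2_eq_square)
  have c': "c = (\<theta>' + (2 * of_nat d + 1))\<^sup>2"
    unfolding c \<theta> distrib_left[symmetric] sq ..
  \<comment> \<open>If \<open>\<theta> \<noteq> e\<close>, the lower end gives c = (\<theta>' -
    1)^2. Of the two ways to match this with the value from the upper end, one would make 2 (d + 1)
    zero.\<close>
  have \<theta>'_cases: "\<theta>' = (if \<theta> = e then 1 else - of_nat d)"
  proof (cases "\<theta> = e")
    case False
    with start have "r = 0" by auto
    then have "(c - (\<theta> - e)\<^sup>2) *s w0 = 0"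
      using P_eigenvector(2)[OF ee w0(2)] w0(3) by simp
    then have "c = (e * (\<theta>' - 1))\<^sup>2" using w0(1) by (simp add: \<theta> algebra_simps)
    then have "(\<theta>' + (2 * of_nat d + 1))\<^sup>2 = (\<theta>' - 1)\<^sup>2" unfolding sq using c' by simp
    then have "\<theta>' + (2 * of_nat d + 1) = \<theta>' - 1 \<or> \<theta>' + (2 * of_nat d + 1) = - (\<theta>' - 1)"
      by (simp only: power2_eq_iff)
    then show ?thesis
    proof
      assume "\<theta>' + (2 * of_nat d + 1) = \<theta>' - 1"
      then have "2 * of_nat (d + 1) = (0 :: 'a)" by (simp add: algebra_simps eq_neg_iff_add_eq_0)
      then have False by (simp only: mult_eq_0_iff of_nat_eq_0_iff) simp
      then show ?thesis ..
    next
      assume "\<theta>' + (2 * of_nat d + 1) = - (\<theta>' - 1)"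
      then have "2 * (\<theta>' + of_nat d) = 0" by (simp add: algebra_simps)
      then have "\<theta>' = - of_nat d" by (simp only: mult_eq_0_iff) (simp add: eq_neg_iff_add_eq_0)
      with False show ?thesis by simp
    qed
  qed (use ee in \<open>simp add: \<theta>'_def\<close>)
  have c'': "c = (if \<theta> = e then 4 else 1) * (of_nat d + 1)\<^sup>2"
    unfolding c' \<theta>'_cases by (simp add: power2_eq_square algebra_simps)
  have g: "g i \<noteq> 0" if "i < d" for i
  proof -
    have g: "g i = (\<theta>' + (2 * of_nat d + 1))\<^sup>2 - (\<theta>' + (2 * of_nat i + 1))\<^sup>2"
      unfolding g_def c' \<theta> distrib_left[symmetric] sq ..
    obtain k where k: "d = Suc (i + k)" using \<open>i < d\<close> less_iff_Suc_add by blast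
    \<comment> \<open>The difference of squares is 4 (d - i) (\<theta>' + d + i + 1), a positive
      integer in both cases, hence nonzero in characteristic zero.\<close>
    have "g i = of_nat (4 * (k + 1) * (if \<theta> = e then d + i + 2 else i + 1))"
      unfolding g \<theta>'_cases by (simp add: k power2_eq_square algebra_simps)
    then show ?thesis by (simp only: of_nat_eq_0_iff) simp
  qed
  have fwd: "P (- (e * (- 1) ^ j)) (w j) = (if j < d then w (j + 1) else 0)" if "j \<le> d" for j
    using that wd w_Suc[of j] by (cases "j = d") auto
  \<comment> \<open>For \<open>j > 0\<close> this sign is the one that led from \<open>j - 1\<close>
    to \<open>j\<close>. At \<open>j = 0\<close> it is \<open>P e\<close> itself, the source of the
    only possible diagonal entry.\<close>
  have bwd: "P (e * (- 1) ^ j) (w j) = (if 0 < j then g (j - 1) *s w (j - 1) else r *s w j)" for j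
    using down[of "j - 1"] w0 w_0 by (cases j) auto
  have Yw: "Y (w j) = (if j < d then (1 / 2) *s w (j + 1) else 0)
      + (if 0 < j then (g (j - 1) / 2) *s w (j - 1) else 0) + (if j = 0 then r / 2 else 0) *s w j"
    if "j \<le> d" for j
    unfolding Y_Z_P(1)[OF ei[of j], of "w j"] fwd[OF that] bwd by (auto simp: algebra_simps)
  have Zw: "Z (w j) = (if j < d then (- (e * (- 1) ^ j) / 2) *s w (j + 1) else 0)
      + (if 0 < j then ((e * (- 1) ^ j) * g (j - 1) / 2) *s w (j - 1) else 0)
      + (if j = 0 then e * r / 2 else 0) *s w j"
    if "j \<le> d" for j
    unfolding Y_Z_P(2)[OF ei[of j], of "w j"] fwd[OF that] bwd by (auto simp: algebra_simps)
  let ?W = "span (w ` {..d})"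
  have in_W: "w i \<in> ?W" if "i \<le> d" for i using that by (intro span_base) auto
  have inv: "T u \<in> ?W" if T: "Vector_Spaces.linear scale scale T"
    and Tw: "\<And>i. i \<le> d \<Longrightarrow> T (w i) \<in> ?W" and "u \<in> ?W" for T u
  proof -
    interpret T: Vector_Spaces.linear scale scale T by (rule T)
    from \<open>u \<in> ?W\<close> show ?thesis
    proof (induction rule: span_induct_alt)
      case base
      show ?case by (simp add: T.zero span_zero)
    next
      case (step a x y)
      then show ?case
        by (auto simp: T.add T.scale intro!: span_add span_scale Tw)
    qed
  qed
  \<comment> \<open>The span of the chain is invariant and contains \<open>w 0\<close>, so
    irreducibility makes it the whole space.\<close>
  have "?W = {0} \<or> ?W = UNIV"
  proof (rule irreducible)
    have "X (w i) \<in> ?W" "Y (w i) \<in> ?W" "Z (w i) \<in> ?W" if "i \<le> d" for i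
      using that by (auto simp: Xw Yw Zw intro!: span_add span_diff span_scale in_W span_zero intro: span_base)
    then show "X u \<in> ?W \<and> Y u \<in> ?W \<and> Z u \<in> ?W" if "u \<in> ?W" for u
      using inv[OF linear_X] inv[OF linear_Y] inv[OF linear_Z] that by blast
  qed simp
  then have "?W = UNIV" using in_W[of 0] nz[of 0] by auto
  then have bf: "basis_family scale d w"
    using sum_eigenvectors_zero[OF linear_X finite_atMost inj, of w] Xw nz
    by (intro basis_familyI) auto
  show thesis
  proof (rule that)
    show "eigenbasis d w (\<lambda>i. (- 1) ^ i * (\<theta> + 2 * e * of_nat i))"
      using bf Xw by (simp add: eigenbasis_def t_def)
    show "inj_on (\<lambda>i. (- 1) ^ i * (\<theta> + 2 * e * of_nat i)) {..d}"
      using inj by (simp add: t_def[abs_def])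
    show "irreducible_tridiagonal d (matrix_of scale d w Y)"
      by (rule irreducible_tridiagonalI[OF bf Yw]) (auto simp: g)
    show "irreducible_tridiagonal d (matrix_of scale d w Z)"
      by (rule irreducible_tridiagonalI[OF bf Zw]) (auto simp: g e0)
  qed (rule c'')
qed

lemma chain_start:
  obtains e w0 \<theta> r where "e = 1 \<or> e = - 1" "w0 \<noteq> 0" "X w0 = \<theta> *s w0" "P e w0 = r *s w0"
    "r = 0 \<and> \<not> eigenvalue 1 \<and> \<not> eigenvalue (- 1) \<or> \<theta> = e"
proof (cases "eigenvalue 1 \<or> eigenvalue (- 1)")
  case True
  then obtain e where e: "e = 1 \<or> e = - 1" "eigenvalue e" by auto
  then obtain v where v: "v \<noteq> 0" "X v = e *s v" by (auto simp: eigenvalue_def)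
  have ee: "e * e = 1" using e by auto
  \<comment> \<open>On the eigenspace for \<open>e\<close> the operator \<open>P e\<close> squares
    to c, so (P_e - s)(P_e + s) v = 0: either \<open>v\<close> or \<open>P e v + s *s v\<close> is
    an eigenvector of \<open>P e\<close>.\<close>
  obtain s where s: "c = s * s" using nth_root_exists[of 2 c] by (auto simp: power2_eq_square)
  show thesis
  proof (cases "P e v = - s *s v")
    case True
    then show thesis using e v by (intro that[of e v e "- s"]) auto
  next
    case False
    let ?u = "P e v + s *s v"
    have "X ?u = e *s ?u"
      using P_eigenvector(1)[OF ee v(2)] by (simp add: X.add X.scale v scale_right_distrib mult.commute)
    moreover have "P e ?u = s *s ?u"
      using P_eigenvector(2)[OF ee v(2)] by (simp add: P.add P.scale s algebra_simps)
    moreover have "?u \<noteq> 0" using False by (simp add: add_eq_0_iff2)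
    ultimately show thesis using e by (intro that) auto
  qed
next
  case False
  obtain v0 :: 'b where "v0 \<noteq> 0" using nontrivial by blast
  then obtain v a where v: "v \<noteq> 0" "X v = a *s v"
    using exists_eigenvector[OF finite_dimensional_vector_space_axioms linear_X] by metis
  show thesis
  proof (rule ccontr)
    assume "\<not> thesis"
    with that[of _ _ _ 0] False
    have nz: "P e u \<noteq> 0" if "e = 1 \<or> e = - 1" "u \<noteq> 0" "X u = \<theta> *s u" for e u \<theta>
      using that by auto
    \<comment> \<open>If no eigenvector were killed, \<open>P 1\<close> after \<open>P (- 1)\<close>
      could be iterated forever, raising the eigenvalue by 4 each time: \<theta> -> -2 - \<theta> ->
      4 + \<theta>.\<close>
    define u where "u i = ((P 1 \<circ> P (- 1)) ^^ i) v" for i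
    have u: "X (u i) = (a + 4 * of_nat i) *s u i \<and> u i \<noteq> 0" for i
    proof (induction i)
      case (Suc i)
      then have Xu: "X (u i) = (a + 4 * of_nat i) *s u i" and "u i \<noteq> 0" by auto
      have "X (P (- 1) (u i)) = (2 * (- 1) - (a + 4 * of_nat i)) *s P (- 1) (u i)"
        by (rule P_eigenvector(1)[OF _ Xu]) simp
      moreover from this have "X (P 1 (P (- 1) (u i))) =
          (2 * 1 - (2 * (- 1) - (a + 4 * of_nat i))) *s P 1 (P (- 1) (u i))"
        by (intro P_eigenvector(1)[where e = 1]) simp_all
      moreover have "2 * 1 - (2 * (- 1) - (a + 4 * of_nat i)) = a + 4 * of_nat (Suc i)"
        by (simp add: algebra_simps)
      moreover have "P 1 (P (- 1) (u i)) \<noteq> 0"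
        using Xu \<open>u i \<noteq> 0\<close> calculation(1) nz by blast
      ultimately show ?case by (simp add: u_def)
    qed (use v in \<open>simp add: u_def\<close>)
    then have "\<exists>n. u n = 0"
      by (intro eigenvector_sequence_vanishes[of u "\<lambda>i. a + 4 * of_nat i"]) auto
    with u show False by blast
  qed
qed

text \<open>Beyond the chain itself, this shows that 1 and -1 are never both eigenvalues: a chain
  starting at \<open>e\<close> has eigenvalues (-1)^i (2i + 1) e, none of which is
  \<open>- e\<close>. This is why only one diagonal entry survives in the almost bipartite
  case.\<close>

lemma leonard_basis:
  obtains d w t where "eigenbasis d w t" "inj_on t {..d}"
    "irreducible_tridiagonal d (matrix_of scale d w Y)"
    "irreducible_tridiagonal d (matrix_of scale d w Z)"
    "(\<not> eigenvalue 1 \<and> \<not> eigenvalue (- 1) \<and> c = (of_nat d + 1)\<^sup>2) \<or>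
     (\<exists>e. (e = 1 \<or> e = - 1) \<and> eigenvalue e \<and> \<not> eigenvalue (- e) \<and> c = 4 * (of_nat d + 1)\<^sup>2)"
proof -
  obtain e w0 \<theta> r where start: "e = 1 \<or> e = - 1" "w0 \<noteq> 0" "X w0 = \<theta> *s w0" "P e w0 = r *s w0"
    "r = 0 \<and> \<not> eigenvalue 1 \<and> \<not> eigenvalue (- 1) \<or> \<theta> = e" by (rule chain_start)
  obtain d w where eb: "eigenbasis d w (\<lambda>i. (- 1) ^ i * (\<theta> + 2 * e * of_nat i))"
    and inj: "inj_on (\<lambda>i. (- 1) ^ i * (\<theta> + 2 * e * of_nat i)) {..d}"
    and irr: "irreducible_tridiagonal d (matrix_of scale d w Y)"
      "irreducible_tridiagonal d (matrix_of scale d w Z)"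
    and c: "c = (if \<theta> = e then 4 else 1) * (of_nat d + 1)\<^sup>2"
    using chain_basis[OF start] by blast
  have "(\<not> eigenvalue 1 \<and> \<not> eigenvalue (- 1) \<and> c = (of_nat d + 1)\<^sup>2) \<or>
     (\<exists>e. (e = 1 \<or> e = - 1) \<and> eigenvalue e \<and> \<not> eigenvalue (- e) \<and> c = 4 * (of_nat d + 1)\<^sup>2)"
  proof (cases "\<theta> = e")
    case True
    have "\<not> eigenvalue (- e)"
    proof
      assume "eigenvalue (- e)"
      then obtain i where "(- 1) ^ i * (e + 2 * e * of_nat i) = - e"
        unfolding eigenvalue_eigenbasis[OF eb] True by auto
      then have "e * ((- 1) ^ i * (1 + 2 * of_nat i) + 1) = 0" by (simp add: algebra_simps)
      then have *: "(- 1) ^ i * (1 + 2 * of_nat i) + 1 = (0 :: 'a)" using start(1) by auto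
      show False
      proof (cases "even i")
        case True
        with * have "of_nat (2 * i + 2) = (0 :: 'a)" by (simp add: algebra_simps)
        then show False by (simp only: of_nat_eq_0_iff)
      next
        case False
        with * have "of_nat (2 * i) = (0 :: 'a)" by simp
        then have "i = 0" by (simp only: of_nat_eq_0_iff)
        with False show False by simp
      qed
    qed
    moreover have "eigenvalue e" using start True by (auto simp: eigenvalue_def)
    ultimately show ?thesis using start(1) c True by auto
  qed (use start c in auto)
  then show thesis by (rule that[OF eb inj irr])
qed

section \<open>The two possible values of the Casimir scalar\<close>

lemma diag_tridiag_basis_exists: "\<exists>d v. diag_tridiag_basis scale d v X Y Z"
  using leonard_basis by (metis diag_tridiag_basis_def eigenbasis_def diagonal_matrix_of_iff)

text \<open>Replacing the length of the chain by the dimension makes the value of \<open>c\<close>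
  comparable for the three operators.\<close>

lemma eigenvalue_dichotomy:
  "(\<not> eigenvalue 1 \<and> \<not> eigenvalue (- 1) \<and> c = (of_nat (dim (UNIV :: 'b set)))\<^sup>2) \<or>
   (\<exists>e. (e = 1 \<or> e = - 1) \<and> eigenvalue e \<and> \<not> eigenvalue (- e) \<and>
      c = 4 * (of_nat (dim (UNIV :: 'b set)))\<^sup>2)"
proof -
  obtain d w t where "eigenbasis d w t" and *: "(\<not> eigenvalue 1 \<and> \<not> eigenvalue (- 1) \<and> c = (of_nat d + 1)\<^sup>2) \<or>
     (\<exists>e. (e = 1 \<or> e = - 1) \<and> eigenvalue e \<and> \<not> eigenvalue (- e) \<and> c = 4 * (of_nat d + 1)\<^sup>2)"
    by (rule leonard_basis)
  then have "of_nat (dim (UNIV :: 'b set)) = (of_nat d + 1 :: 'a)"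
    using basis_family_dim[of d w] by (simp add: eigenbasis_def)
  with * show ?thesis by simp
qed

lemma dim_nonzero: "of_nat (dim (UNIV :: 'b set)) \<noteq> (0 :: 'a)"
proof -
  obtain d v where "basis_family scale d v"
    using diag_tridiag_basis_exists by (auto simp: diag_tridiag_basis_def)
  then show ?thesis unfolding basis_family_dim[OF \<open>basis_family scale d v\<close>] of_nat_eq_0_iff by simp
qed

text \<open>The left-hand sides are unchanged by \<open>rotate\<close>, so the case found for
  \<open>X\<close> holds for \<open>Y\<close> and \<open>Z\<close> too. They exclude each other
  because the dimension is nonzero in the field.\<close>

lemma casimir_cases:
  "c = (of_nat (dim (UNIV :: 'b set)))\<^sup>2 \<longleftrightarrow> \<not> eigenvalue 1 \<and> \<not> eigenvalue (- 1)"
  "c = 4 * (of_nat (dim (UNIV :: 'b set)))\<^sup>2 \<longleftrightarrow> eigenvalue 1 \<or> eigenvalue (- 1)"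
proof -
  have "(of_nat (dim (UNIV :: 'b set)))\<^sup>2 \<noteq> 4 * (of_nat (dim (UNIV :: 'b set)) :: 'a)\<^sup>2"
    using dim_nonzero by simp
  with eigenvalue_dichotomy
  show "c = (of_nat (dim (UNIV :: 'b set)))\<^sup>2 \<longleftrightarrow> \<not> eigenvalue 1 \<and> \<not> eigenvalue (- 1)"
    "c = 4 * (of_nat (dim (UNIV :: 'b set)))\<^sup>2 \<longleftrightarrow> eigenvalue 1 \<or> eigenvalue (- 1)"
    by auto
qed

text \<open>Comparison with a chain basis shows that all eigenspaces of \<open>X\<close> are lines,
  so two vectors of any eigenbasis with equal eigenvalues would be proportional.\<close>

lemma eigenbasis_inj:
  assumes "eigenbasis d v s"
  shows "inj_on s {..d}"
proof (rule inj_onI, rule ccontr)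
  fix i j assume ij: "i \<in> {..d}" "j \<in> {..d}" "s i = s j" "i \<noteq> j"
  have bf: "basis_family scale d v" using assms by (simp add: eigenbasis_def)
  have v: "X (v i) = s i *s v i" "X (v j) = s i *s v j" "v i \<noteq> 0" "v j \<noteq> 0"
    using assms ij basis_family_nonzero[OF bf] by (auto simp: eigenbasis_def)
  obtain d' w t where w: "eigenbasis d' w t" and inj: "inj_on t {..d'}" by (rule leonard_basis)
  then have bf': "basis_family scale d' w" and Xw: "\<And>i. i \<le> d' \<Longrightarrow> X (w i) = t i *s w i"
    by (auto simp: eigenbasis_def)
  obtain k a where k: "k \<le> d'" "t k = s i" "v i = a *s w k"
    by (rule eigenvector_in_eigenbasis[OF bf' linear_X Xw v(1) v(3)]) (use inj in auto)
  obtain l b where l: "l \<le> d'" "t l = s i" "v j = b *s w l"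
    by (rule eigenvector_in_eigenbasis[OF bf' linear_X Xw v(2) v(4)]) (use inj in auto)
  have "k = l" using inj k l by (auto simp: inj_on_def)
  moreover have "a \<noteq> 0" using v(3) k(3) by auto
  ultimately have "v j = (b / a) *s v i" using k(3) l(3) by simp
  then have "(\<Sum>k\<le>d. (if k = j then 1 else 0) *s v k) = (\<Sum>k\<le>d. (if k = i then b / a else 0) *s v k)"
    using ij by (simp add: if_distrib[of "\<lambda>x. x *s _"] cong: if_cong)
  from basis_family_coeffs_eq[OF bf this, of j] ij show False by auto
qed

section \<open>Matrix entries of y and z in an arbitrary eigenbasis of x\<close>

lemma anticommutator_coeffs:
  assumes eb: "eigenbasis d v t" and T: "Vector_Spaces.linear scale scale T"
    and TS: "\<And>v. X (T v) + T (X v) = 2 *s S v" and ij: "i \<le> d" "j \<le> d"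
  shows "(t i + t j) * matrix_of scale d v T i j = 2 * matrix_of scale d v S i j"
proof -
  interpret T: Vector_Spaces.linear scale scale T by (rule T)
  have bf: "basis_family scale d v" and Xv: "\<And>i. i \<le> d \<Longrightarrow> X (v i) = t i *s v i"
    using eb by (auto simp: eigenbasis_def)
  have "(\<Sum>i\<le>d. ((t i + t j) * matrix_of scale d v T i j) *s v i) =
      (\<Sum>i\<le>d. matrix_of scale d v T i j *s X (v i)) + t j *s (\<Sum>i\<le>d. matrix_of scale d v T i j *s v i)"
    unfolding scale_sum_right sum.distrib[symmetric]
    by (intro sum.cong) (auto simp: Xv algebra_simps)
  also have "\<dots> = X (\<Sum>i\<le>d. matrix_of scale d v T i j *s v i) + t j *s (\<Sum>i\<le>d. matrix_of scale d v T i j *s v i)"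
    by (simp add: X.sum X.scale)
  also have "\<dots> = X (T (v j)) + T (X (v j))"
    unfolding matrix_of_sum[OF bf, of T j, symmetric] using ij by (simp add: Xv T.scale)
  also have "\<dots> = 2 *s (\<Sum>i\<le>d. matrix_of scale d v S i j *s v i)"
    unfolding TS matrix_of_sum[OF bf, of S j, symmetric] ..
  also have "\<dots> = (\<Sum>i\<le>d. (2 * matrix_of scale d v S i j) *s v i)"
    by (simp add: scale_sum_right)
  finally show ?thesis by (rule basis_family_coeffs_eq[OF bf _ ij(1)])
qed

text \<open>The relations for xy + yx and zx + xz express the entries of \<open>Z\<close> and
  \<open>Y\<close> through each other; eliminating \<open>Z\<close> gives ((t_i + t_j)^2 - 4) Y_ij =
  0.\<close>

lemma matrix_Y_Z:
  assumes "eigenbasis d v t" "i \<le> d" "j \<le> d"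
  shows "2 * matrix_of scale d v Z i j = (t i + t j) * matrix_of scale d v Y i j"
    and "matrix_of scale d v Y i j \<noteq> 0 \<Longrightarrow> t i = 2 - t j \<or> t i = - 2 - t j"
proof -
  show Z: "2 * matrix_of scale d v Z i j = (t i + t j) * matrix_of scale d v Y i j"
    using anticommutator_coeffs[OF assms(1) linear_Y XY assms(2,3)] by simp
  have "(t i + t j) * matrix_of scale d v Z i j = 2 * matrix_of scale d v Y i j"
    using anticommutator_coeffs[OF assms(1) linear_Z _ assms(2,3), of Y] ZX by (simp add: add.commute)
  then have "(t i + t j) * (2 * matrix_of scale d v Z i j) = 4 * matrix_of scale d v Y i j" by simp
  then have "((t i + t j)\<^sup>2 - 2\<^sup>2) * matrix_of scale d v Y i j = 0"
    unfolding Z by (simp add: power2_eq_square algebra_simps)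
  moreover assume "matrix_of scale d v Y i j \<noteq> 0"
  ultimately have "(t i + t j)\<^sup>2 = 2\<^sup>2" by simp
  then have "t i + t j = 2 \<or> t i + t j = - 2" by (simp only: power2_eq_iff)
  then show "t i = 2 - t j \<or> t i = - 2 - t j" by (auto simp: eq_diff_eq)
qed

lemma matrix_diagonal:
  assumes "eigenbasis d v t" "i \<le> d"
  shows "matrix_of scale d v Z i i = t i * matrix_of scale d v Y i i"
    and "matrix_of scale d v Y i i \<noteq> 0 \<Longrightarrow> t i = 1 \<or> t i = - 1"
proof -
  show "matrix_of scale d v Z i i = t i * matrix_of scale d v Y i i"
    using matrix_Y_Z(1)[OF assms assms(2)] by simp
  assume "matrix_of scale d v Y i i \<noteq> 0"
  from matrix_Y_Z(2)[OF assms assms(2) this] have "2 * t i = 2 * 1 \<or> 2 * t i = 2 * - 1"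
    by (auto simp: algebra_simps)
  then show "t i = 1 \<or> t i = - 1" by (simp only: mult_cancel_left) simp
qed

section \<open>The shape of the tridiagonal matrices\<close>

lemma diag_tridiag_basis_eigenbasis:
  assumes "diag_tridiag_basis scale d v X Y Z"
  obtains t where "eigenbasis d v t"
proof -
  from assms have bf: "basis_family scale d v" and "diagonal_matrix d (matrix_of scale d v X)"
    by (auto simp: diag_tridiag_basis_def)
  then obtain t where "\<forall>i\<le>d. X (v i) = t i *s v i" by (auto simp: diagonal_matrix_of_iff)
  with bf show thesis by (intro that[of t]) (simp add: eigenbasis_def)
qed

lemma bipartite_matrices:
  assumes "diag_tridiag_basis scale d v X Y Z" "c = (of_nat (dim (UNIV :: 'b set)))\<^sup>2"
  shows "bipartite d (matrix_of scale d v Y) \<and> bipartite d (matrix_of scale d v Z)"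
proof -
  obtain t where t: "eigenbasis d v t" by (rule diag_tridiag_basis_eigenbasis[OF assms(1)])
  have "matrix_of scale d v Y i i = 0" if "i \<le> d" for i
    using matrix_diagonal(2)[OF t that] assms(2) that
    unfolding casimir_cases eigenvalue_eigenbasis[OF t] by auto
  then show ?thesis using assms(1) matrix_diagonal(1)[OF t]
    by (simp add: diag_tridiag_basis_def irreducible_tridiagonal_def bipartite_def)
qed

lemma almost_bipartite_matrices:
  assumes dt: "diag_tridiag_basis scale d v X Y Z" and c: "c = 4 * (of_nat (dim (UNIV :: 'b set)))\<^sup>2"
  shows "almost_bipartite d (matrix_of scale d v Y) \<and> almost_bipartite d (matrix_of scale d v Z)"
proof -
  obtain t where t: "eigenbasis d v t" by (rule diag_tridiag_basis_eigenbasis[OF dt])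
  have bf: "basis_family scale d v" and Xv: "\<And>i. i \<le> d \<Longrightarrow> X (v i) = t i *s v i"
    using t by (auto simp: eigenbasis_def)
  have inj: "inj_on t {..d}" by (rule eigenbasis_inj[OF t])
  obtain e where e: "e = 1 \<or> e = - 1" "eigenvalue e" "\<not> eigenvalue (- e)"
    using eigenvalue_dichotomy c unfolding casimir_cases by auto
  then obtain k where k: "k \<le> d" "t k = e" by (auto simp: eigenvalue_eigenbasis[OF t])
  have diag0: "matrix_of scale d v Y i i = 0" if "i \<le> d" "i \<noteq> k" for i
  proof (rule ccontr)
    assume "matrix_of scale d v Y i i \<noteq> 0"
    then have "t i = e \<or> t i = - e" using matrix_diagonal(2)[OF t that(1)] e(1) by auto
    moreover have "t i \<noteq> - e" using e(3) that by (auto simp: eigenvalue_eigenbasis[OF t])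
    ultimately show False using inj k that by (auto simp: inj_on_def)
  qed
  have ee: "e * e = 1" using e(1) by auto
  have "c \<noteq> 0" using c dim_nonzero by simp
  \<comment> \<open>\<open>P e\<close> maps the line of \<open>v k\<close> to itself, with factor
    Y_kk + e Z_kk. A zero factor would contradict P_e^2 = c there, as \<open>c\<close> is
    nonzero.\<close>
  have Ykk: "matrix_of scale d v Y k k \<noteq> 0"
  proof
    assume Y0: "matrix_of scale d v Y k k = 0"
    then have Z0: "matrix_of scale d v Z k k = 0" using matrix_diagonal(1)[OF t k(1)] by simp
    have Xk: "X (v k) = e *s v k" using Xv[OF k(1)] k(2) by simp
    have "P e (v k) = 0"
    proof (rule ccontr)
      assume nz: "P e (v k) \<noteq> 0"
      have XP: "X (P e (v k)) = e *s P e (v k)" using P_eigenvector(1)[OF ee Xk] by simp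
      obtain l a where l: "l \<le> d" "t l = e" "P e (v k) = a *s v l"
        by (rule eigenvector_in_eigenbasis[OF bf linear_X Xv XP nz]) (use inj in auto)
      have "l = k" using inj k l by (auto simp: inj_on_def)
      then have P: "P e (v k) = a *s v k" using l by simp
      have "(\<Sum>i\<le>d. (matrix_of scale d v Y i k + e * matrix_of scale d v Z i k) *s v i) = P e (v k)"
        unfolding P_def matrix_of_sum[OF bf, of Y k] matrix_of_sum[OF bf, of Z k]
        by (simp add: scale_sum_right scale_left_distrib sum.distrib)
      also have "\<dots> = (\<Sum>i\<le>d. (if i = k then a else 0) *s v i)"
        unfolding P using k(1) by (simp add: if_distrib[of "\<lambda>x. x *s _"] cong: if_cong)
      finally have "matrix_of scale d v Y k k + e * matrix_of scale d v Z k k = (if k = k then a else 0)"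
        by (rule basis_family_coeffs_eq[OF bf _ k(1)])
      then have "a = 0" using Y0 Z0 by simp
      with P nz show False by simp
    qed
    then have "c *s v k = 0" using P_eigenvector(2)[OF ee Xk] by simp
    with \<open>c \<noteq> 0\<close> basis_family_nonzero[OF bf k(1)] show False by simp
  qed
  have tri: "tridiagonal d (matrix_of scale d v Y)" "tridiagonal d (matrix_of scale d v Z)"
    and off: "\<And>i. i < d \<Longrightarrow> matrix_of scale d v Y (i + 1) i \<noteq> 0 \<and> matrix_of scale d v Y i (i + 1) \<noteq> 0"
    using dt by (auto simp: diag_tridiag_basis_def irreducible_tridiagonal_def)
  \<comment> \<open>A neighbour of \<open>k\<close> has eigenvalue 2 - e or -2 - e. One of these is
    \<open>e\<close>, taken by \<open>k\<close>, and the other is -3e, so there is room for only one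
    neighbour.\<close>
  have end_k: "k = 0 \<or> k = d"
  proof (rule ccontr)
    assume "\<not> ?thesis"
    then have kd: "0 < k" "k < d" using k(1) by auto
    have nb: "t i = - 3 * e" if "matrix_of scale d v Y i k \<noteq> 0" "i \<le> d" "i \<noteq> k" for i
    proof -
      have "t i = 2 - e \<or> t i = - 2 - e" using matrix_Y_Z(2)[OF t that(2) k(1) that(1)] k(2) by simp
      moreover have "t i \<noteq> e" using inj k that by (auto simp: inj_on_def)
      ultimately show ?thesis using e(1) by auto
    qed
    have "t (k + 1) = - 3 * e" using off[of k] kd by (intro nb) auto
    moreover have "t (k - 1) = - 3 * e" using off[of "k - 1"] kd by (intro nb) auto
    ultimately have "k + 1 = k - 1" using inj kd by (auto simp: inj_on_def)
    then show False by simp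
  qed
  have Zii: "matrix_of scale d v Z i i = 0 \<longleftrightarrow> matrix_of scale d v Y i i = 0" if "i \<le> d" for i
    using matrix_diagonal(1)[OF t that] diag0[OF that] k(2) e(1) by (cases "i = k") auto
  have "almost_bipartite d (matrix_of scale d v Y)"
    using tri diag0 Ykk end_k k(1) by (auto simp: almost_bipartite_def)
  moreover from this have "almost_bipartite d (matrix_of scale d v Z)"
    using tri Zii by (auto simp: almost_bipartite_def)
  ultimately show ?thesis ..
qed

section \<open>Passing to all three operators by rotation\<close>

lemma leonard_triple: "leonard_triple scale X Y Z"
proof -
  interpret YZX: anticommutator_triple scale Basis Y Z X c by (rule rotate)
  interpret ZXY: anticommutator_triple scale Basis Z X Y c by (rule YZX.rotate)
  show ?thesis unfolding leonard_triple_def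
    using linear_X linear_Y linear_Z diag_tridiag_basis_exists YZX.diag_tridiag_basis_exists
      ZXY.diag_tridiag_basis_exists by blast
qed

lemma totally_bipartite:
  assumes "c = (of_nat (dim (UNIV :: 'b set)))\<^sup>2"
  shows "totally_bipartite scale X Y Z"
proof -
  interpret YZX: anticommutator_triple scale Basis Y Z X c by (rule rotate)
  interpret ZXY: anticommutator_triple scale Basis Z X Y c by (rule YZX.rotate)
  show ?thesis unfolding totally_bipartite_def all_tridiagonal_matrices_def
    using leonard_triple assms bipartite_matrices YZX.bipartite_matrices ZXY.bipartite_matrices by blast
qed

lemma totally_almost_bipartite:
  assumes "c = 4 * (of_nat (dim (UNIV :: 'b set)))\<^sup>2"
  shows "totally_almost_bipartite scale X Y Z"
proof -
  interpret YZX: anticommutator_triple scale Basis Y Z X c by (rule rotate)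
  interpret ZXY: anticommutator_triple scale Basis Z X Y c by (rule YZX.rotate)
  show ?thesis unfolding totally_almost_bipartite_def all_tridiagonal_matrices_def
    using leonard_triple assms almost_bipartite_matrices YZX.almost_bipartite_matrices
      ZXY.almost_bipartite_matrices by blast
qed

end

section \<open>Modules over the algebra\<close>

lemma poly_mapping_induct_sum [case_names single sum]:
  fixes p :: "'a \<Rightarrow>\<^sub>0 'b::monoid_add"
  assumes single: "\<And>k b. Q (Poly_Mapping.single k b)"
    and sum: "\<And>p q. Q p \<Longrightarrow> Q q \<Longrightarrow> Q (p + q)"
  shows "Q p"
proof (induction p rule: update_induct)
  case const
  \<comment> \<open>The zero mapping counts as a monomial with coefficient 0.\<close>
  show ?case using single[of undefined 0] by simp
next
  case (update f a b)
  then have "Poly_Mapping.update a b f = f + Poly_Mapping.single a b"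
    by (intro poly_mapping_eqI) (auto simp: lookup_update lookup_add lookup_single in_keys_iff)
  with update single sum show ?case by simp
qed

context acsa_module
begin

text \<open>Homogeneity holds because scalars commute with all monomials of the free algebra, hence
  are central in the quotient.\<close>

lemma linear_act: "Vector_Spaces.linear scale scale (act a)"
proof unfold_locales
  fix r v
  have "acsa_scalar r * a = a * acsa_scalar r"
  proof transfer
    fix r :: 'k and a :: "'k free_alg"
    have "free_scalar r * a = a * free_scalar r"
    proof (induction a rule: poly_mapping_induct_sum)
      case (single k v)
      then show ?case by (simp add: free_scalar_def mult_single mult.commute)
    next
      case (sum p q)
      then show ?case by (simp add: algebra_simps)
    qed
    then show "rel_cong (free_scalar r * a) (a * free_scalar r)"
      by (simp add: rel_cong_def rel_ideal.zero)
  qed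
  then show "act a (scale r v) = scale r (act a v)"
    by (metis act_mult act_scalar)
qed (rule act_add_right)

text \<open>The elements of the algebra that preserve \<open>W\<close> contain scalars and
  generators and are closed under sums and products, hence are all of it.\<close>

lemma act_gen_closed:
  assumes W: "subspace W" and gens: "\<And>g w. w \<in> W \<Longrightarrow> act (acsa_gen g) w \<in> W" and "w \<in> W"
  shows "act a w \<in> W"
proof -
  define S where "S = {a. \<forall>w\<in>W. act a w \<in> W}"
  have scalar: "acsa_scalar r \<in> S" for r
    using W by (auto simp: S_def act_scalar subspace_scale)
  have add: "a + b \<in> S" if "a \<in> S" "b \<in> S" for a b
    using that W by (auto simp: S_def act_add_left subspace_add)
  have mult: "a * b \<in> S" if "a \<in> S" "b \<in> S" for a b
    using that by (auto simp: S_def act_mult)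
  have word: "abs_acsa (Poly_Mapping.single (Word l) r) \<in> S" for l r
  proof (induction l)
    case Nil
    show ?case using scalar[of r]
      by (simp add: acsa_scalar.abs_eq free_scalar_def zero_word_def)
  next
    case (Cons g l)
    have "Poly_Mapping.single (Word (g # l)) r = free_gen g * Poly_Mapping.single (Word l) r"
      by (simp add: free_gen_def mult_single plus_word_def)
    then have "abs_acsa (Poly_Mapping.single (Word (g # l)) r) =
        acsa_gen g * abs_acsa (Poly_Mapping.single (Word l) r)"
      by (simp add: acsa_gen.abs_eq times_acsa.abs_eq)
    moreover have "acsa_gen g \<in> S" using gens by (simp add: S_def)
    ultimately show ?case using Cons mult by simp
  qed
  have "abs_acsa p \<in> S" for p
  proof (induction p rule: poly_mapping_induct_sum)
    case (single k r)
    show ?case using word[of "letters k" r] by simp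
  next
    case (sum p q)
    then show ?case using add by (simp flip: plus_acsa.abs_eq)
  qed
  then have "a \<in> S" by (induction a rule: acsa.abs_induct)
  with \<open>w \<in> W\<close> show ?thesis by (simp add: S_def)
qed

lemma act_relations:
  "act (acsa_gen GX) (act (acsa_gen GY) v) + act (acsa_gen GY) (act (acsa_gen GX) v) =
    scale 2 (act (acsa_gen GZ) v)"
  "act (acsa_gen GY) (act (acsa_gen GZ) v) + act (acsa_gen GZ) (act (acsa_gen GY) v) =
    scale 2 (act (acsa_gen GX) v)"
  "act (acsa_gen GZ) (act (acsa_gen GX) v) + act (acsa_gen GX) (act (acsa_gen GZ) v) =
    scale 2 (act (acsa_gen GY) v)"
  unfolding act_mult[symmetric] act_add_left[symmetric] acsa_relations
  by (simp_all only: act_mult act_scalar)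

end

theorem theorem7p5:
  fixes scale :: "'k::{alg_closed_field, field_char_0} \<Rightarrow> 'v::ab_group_add \<Rightarrow> 'v"
    and act :: "'k acsa \<Rightarrow> 'v \<Rightarrow> 'v"
  assumes "acsa_module scale act"
    and "acsa_module.finite_dimensional_module scale"
    and "acsa_module.irreducible_module scale act"
  shows "leonard_triple scale
      (act (acsa_gen GX)) (act (acsa_gen GY)) (act (acsa_gen GZ)) \<and>
    (acsa_module.type_B scale act \<longrightarrow> totally_bipartite scale
      (act (acsa_gen GX)) (act (acsa_gen GY)) (act (acsa_gen GZ))) \<and>
    (acsa_module.type_AB scale act \<longrightarrow> totally_almost_bipartite scale
      (act (acsa_gen GX)) (act (acsa_gen GY)) (act (acsa_gen GZ)))"
proof -
  interpret acsa_module scale act by fact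
  obtain Basis where "finite_dimensional_vector_space scale Basis"
    using assms(2) by (auto simp: finite_dimensional_module_def)
  then interpret finite_dimensional_vector_space scale Basis .
  interpret anticommutator_module scale Basis
    "act (acsa_gen GX)" "act (acsa_gen GY)" "act (acsa_gen GZ)"
  proof (intro anticommutator_module.intro anticommutator_module_axioms.intro)
    fix W assume W: "subspace W" "\<And>w. w \<in> W \<Longrightarrow>
      act (acsa_gen GX) w \<in> W \<and> act (acsa_gen GY) w \<in> W \<and> act (acsa_gen GZ) w \<in> W"
    have "act (acsa_gen g) w \<in> W" if "w \<in> W" for g w
      using W(2)[OF that] by (cases g) auto
    then have "submodule W" using W(1) act_gen_closed by (auto simp: submodule_def)
    then show "W = {0} \<or> W = UNIV" using assms(3) by (auto simp: irreducible_module_def)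
  qed (use assms(3) linear_act act_relations finite_dimensional_vector_space_axioms
    in \<open>auto simp: irreducible_module_def\<close>)
  obtain a where a: "\<And>v. act (acsa_gen GX) (act (acsa_gen GX) v) +
      act (acsa_gen GY) (act (acsa_gen GY) v) + act (acsa_gen GZ) (act (acsa_gen GZ) v) = scale a v"
    using casimir_scalar by blast
  \<comment> \<open>The parameter is \<open>a + 1\<close> because the locale writes the Casimir
    scalar as \<open>c - 1\<close>.\<close>
  interpret anticommutator_triple scale Basis
    "act (acsa_gen GX)" "act (acsa_gen GY)" "act (acsa_gen GZ)" "a + 1"
    by unfold_locales (simp add: a)
  have "\<not> eigenvalue 1 \<and> \<not> eigenvalue (- 1)" if type_B
  proof -
    from that obtain d v where "even d" and bf: "basis_family scale d v" and
      "\<And>i. i \<le> d \<Longrightarrow> act (acsa_gen GX) (v i) = scale ((- 1) ^ i * (of_nat d - 2 * of_nat i)) (v i)"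
      unfolding type_B_def type_B_d_def Let_def by blast
    then have eb: "eigenbasis d v (\<lambda>i. (- 1) ^ i * (of_nat d - 2 * of_nat i))"
      by (simp add: eigenbasis_def)
    have False if "(- 1) ^ i * (of_nat d - 2 * of_nat i) = (1 :: 'k) \<or>
      (- 1) ^ i * (of_nat d - 2 * of_nat i) = (- 1 :: 'k)" for i
    proof -
      have "a = 1 \<or> a = - 1" if "(- 1) ^ i * a = 1 \<or> (- 1) ^ i * a = - 1" for a :: 'k
        using that by (cases "even i") (auto simp: minus_equation_iff[of a])
      from this[OF that]
      \<comment> \<open>Both equations are moved to \<open>of_nat\<close> without subtraction, so
        that parity can be compared in the natural numbers.\<close>
      have "of_nat d = (of_nat (2 * i + 1) :: 'k) \<or> of_nat (d + 1) = (of_nat (2 * i) :: 'k)"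
        by (auto simp: algebra_simps)
      then have "d = 2 * i + 1 \<or> d + 1 = 2 * i" by (simp only: of_nat_eq_iff)
      then have "odd d" by presburger
      with \<open>even d\<close> show False by simp
    qed
    then show ?thesis unfolding eigenvalue_eigenbasis[OF eb] by blast
  qed
  moreover have "eigenvalue 1 \<or> eigenvalue (- 1)" if type_AB
  proof -
    from that obtain d n v where bf: "basis_family scale d v" and
      "\<And>i. i \<le> d \<Longrightarrow> act (acsa_gen GX) (v i) =
         scale (hat GX n * (- 1) ^ (d + i) * (2 * of_nat d - 2 * of_nat i + 1)) (v i)"
      unfolding type_AB_def type_AB_dn_def Let_def by blast
    \<comment> \<open>At the last index the factor 2d - 2i + 1 is 1 and the sign (-1)^(2d)
      disappears, leaving the eigenvalue 1 or -1.\<close>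
    from this(2)[of d] have "act (acsa_gen GX) (v d) = scale (hat GX n) (v d)" by simp
    moreover have "v d \<noteq> 0" by (rule basis_family_nonzero[OF bf]) simp
    ultimately have "eigenvalue (hat GX n)" by (auto simp: eigenvalue_def)
    then show ?thesis by (auto simp: hat_def split: if_splits)
  qed
  ultimately show ?thesis
    using leonard_triple totally_bipartite totally_almost_bipartite
    unfolding casimir_cases by blast
qed

end
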